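(* Consider PIQP instances with at most logarithmically many linear constraints ($p\leq\log n$) and with $\min_i W_i\geq\beta(n)$. For any arbitrarily small constant $\gamma>0$, there is a polynomial-time randomized algorithm that, with high probability, approximates PIQP to within a factor of $O\!\left(a_{\max}\frac{n}{\beta(n)}\log^{2+\gamma}n\right)$, where $a_{\max}$ is the maximum entry of the constraint matrix $A=(a_{ij})$.
   Context: PIQP (Positive 0-1 Quadratic Program): given a symmetric matrix $B=(b_{ij})\in\mathbb{Z}_{\geq 0}^{n\times n}$, a positive integer vector $c$, constraint vectors $a_1,\dots,a_p$ with nonnegative integer entries $a_{ij}$ (forming the matrix $A$), and positive bounds $W_1,\dots,W_p$, maximize $X^TBX+c^TX$ subject to $a_i^TX\leq W_i$ ($i=1,\dots,p$) and $X\in\{0,1\}^n$. Approximating within factor $\alpha$ means outputting a feasible solution whose objective value is at least $1/\alpha$ times the optimum. $\beta(n)$ is a positive function of $n$.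
   Formalization: The approximation factor is taken as the maximum of 1 and the stated O-bound, since for large β(n) or a_max = 0 the bound falls below 1, which no algorithm can achieve. *)

theory Defs
  imports
    "HOL-Probability.SPMF"
    "HOL-Library.Log_Nat"
    "HOL-Computational_Algebra.Polynomial"
    "Jordan_Normal_Form.Matrix"
begin

no_notation inner (infix \<open>\<bullet>\<close> 70)
no_notation vec_nth (infixl \<open>$\<close> 90)

section \<open>Positive 0-1 quadratic programs\<close>

record piqp =
  quad :: "nat mat"
  lin :: "nat vec"
  constr :: "nat mat"
  bound :: "rat vec"

abbreviation nvars :: "piqp \<Rightarrow> nat" where "nvars I \<equiv> dim_vec (lin I)"

abbreviation nconstr :: "piqp \<Rightarrow> nat" where "nconstr I \<equiv> dim_vec (bound I)"

definition is_piqp :: "piqp \<Rightarrow> bool" where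
  "is_piqp I \<longleftrightarrow>
     quad I \<in> carrier_mat (nvars I) (nvars I) \<and> transpose_mat (quad I) = quad I \<and>
     (\<forall>j < nvars I. lin I $ j > 0) \<and>
     constr I \<in> carrier_mat (nconstr I) (nvars I) \<and>
     (\<forall>i < nconstr I. bound I $ i > 0)"

definition feasible :: "piqp \<Rightarrow> nat vec \<Rightarrow> bool" where
  "feasible I X \<longleftrightarrow>
     X \<in> carrier_vec (nvars I) \<and> (\<forall>j < nvars I. X $ j \<in> {0, 1}) \<and>
     (\<forall>i < nconstr I. of_nat (row (constr I) i \<bullet> X) \<le> bound I $ i)"

definition objective :: "piqp \<Rightarrow> nat vec \<Rightarrow> nat" where
  "objective I X = X \<bullet> (quad I *\<^sub>v X) + lin I \<bullet> X"

definition optimum :: "piqp \<Rightarrow> nat" where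
  "optimum I = Max (objective I ` {X. feasible I X})"

definition approx_solution :: "piqp \<Rightarrow> real \<Rightarrow> nat vec \<Rightarrow> bool" where
  "approx_solution I \<alpha> X \<longleftrightarrow> feasible I X \<and> real (objective I X) \<ge> 1 / \<alpha> * real (optimum I)"

text \<open>The inserted 0 does not affect a nonempty matrix; it only fixes the value when there are
  no constraints.\<close>
definition a_max :: "piqp \<Rightarrow> nat" where
  "a_max I = Max (insert 0 (elements_mat (constr I)))"


section \<open>Randomized random-access programs with logarithmic cost\<close>

text \<open>The machine model is a random-access machine over the natural numbers with fair coin
  flips, presented as a structured language. The memory of a program consists of the finitely many
  arrays that it names; array indices are computed at run time. Costs follow the logarithmic
  criterion: evaluating an expression costs at least the binary length of every value that occurs in
  it (operands, addresses, and contents of memory cells). Hence multiplication and division cannot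
  be abused and polynomial time agrees with polynomial time on Turing machines.\<close>

type_synonym mem = "string \<Rightarrow> nat \<Rightarrow> nat"

datatype binop = Plus | Minus | Times | Div | Mod

datatype expr = Const nat | Read string expr | Op binop expr expr

datatype com =
    Skip
  | Assign string expr expr  \<comment> \<open>array, index, value\<close>
  | Flip string expr
  | Seq com com
  | If expr com com
  | While expr com

fun opval :: "binop \<Rightarrow> nat \<Rightarrow> nat \<Rightarrow> nat" where
  "opval Plus a b = a + b"
| "opval Minus a b = a - b"
| "opval Times a b = a * b"
| "opval Div a b = a div b"
| "opval Mod a b = a mod b"

fun val :: "expr \<Rightarrow> mem \<Rightarrow> nat" where
  "val (Const k) s = k"
| "val (Read x e) s = s x (val e s)"
| "val (Op f e1 e2) s = opval f (val e1 s) (val e2 s)"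

abbreviation bits :: "nat \<Rightarrow> nat" where "bits \<equiv> floorlog 2"

fun cost :: "expr \<Rightarrow> mem \<Rightarrow> nat" where
  "cost (Const k) s = 1 + bits k"
| "cost (Read x e) s = 1 + cost e s + bits (val (Read x e) s)"
| "cost (Op f e1 e2) s = 1 + cost e1 s + cost e2 s + bits (val (Op f e1 e2) s)"

definition store :: "string \<Rightarrow> nat \<Rightarrow> nat \<Rightarrow> mem \<Rightarrow> mem" where
  "store x i v s = s(x := (s x)(i := v))"

text \<open>A configuration is a memory with the time used so far; the missing mass of the resulting
  subprobability is the probability of nontermination. A guard is true iff it is nonzero.\<close>

partial_function (spmf) loop ::
  "expr \<Rightarrow> (mem \<times> nat \<Rightarrow> (mem \<times> nat) spmf) \<Rightarrow> mem \<times> nat \<Rightarrow> (mem \<times> nat) spmf" where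
  "loop b body \<sigma> =
     (let s = fst \<sigma>; \<tau> = (s, snd \<sigma> + 1 + cost b s)
      in if val b s \<noteq> 0 then bind_spmf (body \<tau>) (loop b body) else return_spmf \<tau>)"

primrec exec :: "com \<Rightarrow> mem \<times> nat \<Rightarrow> (mem \<times> nat) spmf" where
  "exec Skip = (\<lambda>(s, t). return_spmf (s, t + 1))"
| "exec (Assign x i e) = (\<lambda>(s, t).
     return_spmf (store x (val i s) (val e s) s, t + 1 + cost i s + cost e s))"
| "exec (Flip x i) = (\<lambda>(s, t).
     map_spmf (\<lambda>b. (store x (val i s) (of_bool b) s, t + 1 + cost i s)) coin_spmf)"
| "exec (Seq c1 c2) = (\<lambda>\<sigma>. bind_spmf (exec c1 \<sigma>) (exec c2))"
| "exec (If b c1 c2) = (\<lambda>(s, t).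
     (if val b s \<noteq> 0 then exec c1 else exec c2) (s, t + 1 + cost b s))"
| "exec (While b c) = loop b (exec c)"


section \<open>Running a program on an instance\<close>

text \<open>Matrices are stored row by row. A bound is stored as numerator and denominator in lowest
  terms. All memory cells not mentioned are initially 0.\<close>

definition load :: "piqp \<Rightarrow> mem" where
  "load I = (\<lambda>x k. let n = nvars I; p = nconstr I in
     if x = ''n'' \<and> k = 0 then n
     else if x = ''p'' \<and> k = 0 then p
     else if x = ''B'' \<and> k < n * n then quad I $$ (k div n, k mod n)
     else if x = ''c'' \<and> k < n then lin I $ k
     else if x = ''A'' \<and> k < p * n then constr I $$ (k div n, k mod n)
     else if x = ''Wnum'' \<and> k < p then nat (fst (quotient_of (bound I $ k)))
     else if x = ''Wden'' \<and> k < p then nat (snd (quotient_of (bound I $ k)))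
     else 0)"

definition input_size :: "piqp \<Rightarrow> nat" where
  "input_size I = (let n = nvars I; p = nconstr I; cell = (\<lambda>x k. 1 + bits (load I x k)) in
     cell ''n'' 0 + cell ''p'' 0 + (\<Sum>k<n * n. cell ''B'' k) + (\<Sum>k<n. cell ''c'' k) +
     (\<Sum>k<p * n. cell ''A'' k) + (\<Sum>k<p. cell ''Wnum'' k) + (\<Sum>k<p. cell ''Wden'' k))"

definition result :: "piqp \<Rightarrow> mem \<Rightarrow> nat vec" where
  "result I s = vec (nvars I) (s ''X'')"

definition run :: "com \<Rightarrow> piqp \<Rightarrow> nat vec spmf" where
  "run M I = map_spmf (\<lambda>(s, t). result I s) (exec M (load I, 0))"

text \<open>The bound is worst case over the coin flips, on every instance.\<close>
definition polynomial_time :: "com \<Rightarrow> bool" where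
  "polynomial_time M \<longleftrightarrow>
     (\<exists>q :: nat poly. \<forall>I. is_piqp I \<longrightarrow>
        lossless_spmf (exec M (load I, 0)) \<and>
        (\<forall>(s, t) \<in> set_spmf (exec M (load I, 0)). t \<le> poly q (input_size I)))"

text \<open>With high probability means with probability at least \<open>1 - 1/n\<close>.\<close>
definition approximates_whp :: "com \<Rightarrow> piqp \<Rightarrow> real \<Rightarrow> bool" where
  "approximates_whp M I \<alpha> \<longleftrightarrow>
     measure (measure_spmf (run M I)) {X. approx_solution I \<alpha> X} \<ge> 1 - 1 / real (nvars I)"

end

theory Submission
  imports Defs
begin

text \<open>The algorithm is deterministic. Give item \<open>v\<close> the weight \<open>w\<^sub>v = \<Sum>\<^sub>i a\<^sub>i\<^sub>v / W\<^sub>i\<close>: every set of weight at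
  most 1 is feasible, and every feasible set has weight at most \<open>p\<close>. Write \<open>r = n a\<^sub>m\<^sub>a\<^sub>x / \<beta>\<close>; the total
  weight is at most \<open>p r\<close>. If the set of all items is feasible, it is optimal; otherwise \<open>r > 1\<close>. Call
  an item small if its weight is at most 1/4.

  For the small items, order by the ratio of weight to degree, and let \<open>H\<close> be the longest prefix of
  weight at most 1/2. Its total degree is at least \<open>1 / (5 p)\<close> times that of the small part of an
  optimal solution. The small items split into \<open>O(p r)\<close> index intervals of weight at most 1/2, and adding
  the best of them to \<open>H\<close> gains an \<open>\<Omega>(1 / (p r))\<close> fraction of the degree of \<open>H\<close>. A solution contains at
  most \<open>4 p\<close> large items, and their contribution is at most \<open>12 p n\<close> times the best pair; if there
  are large items at all, then \<open>n \<le> 4 p r\<close>. So the best of polynomially many explicit candidates is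
  within a factor \<open>O(p\<^sup>2 r)\<close> of the optimum, and \<open>p\<^sup>2 \<le> log\<^sup>2 n\<close>.\<close>

section \<open>Greedy prefixes for the quadratic knapsack problem\<close>

text \<open>Greedy selection suits linear objectives, whereas \<open>worth\<close> is quadratic.
  Summing \<open>degree\<close> over the small part of a solution bounds the worth of that part from
  above, but the degrees of the prefix \<open>H\<close> also count products with items outside
  \<open>H\<close>, so \<open>H\<close> alone may realise almost nothing of them. The intervals
  repair this: together they cover all small items, and adding the best one realises its share. The
  thresholds follow from this plan. \<open>H\<close> and the interval get capacity 1/2 each, and
  since small items weigh at most 1/4, a maximal prefix or interval fills at least 1/4 unless the
  items run out. Since only the value of the best candidate enters, the program needs no sorting: it
  enumerates pivots and interval ends, and membership in a prefix is decided item by item by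
  comparison with the pivot. The constant is 78 = 30 + 48, where 30 = 5 * 6 comes from the exchange
  argument and the intervals, and 48 = 4 * 3 * 4 from the large items.\<close>

locale quadratic_knapsack =
  fixes n :: nat and w c :: "nat \<Rightarrow> real" and b :: "nat \<Rightarrow> nat \<Rightarrow> real"
  assumes w_nonneg: "\<And>v. 0 \<le> w v"
    and c_pos: "\<And>v. v < n \<Longrightarrow> 0 < c v"
    and b_nonneg: "\<And>u v. 0 \<le> b u v"
begin

definition small :: "nat set" where "small = {v. v < n \<and> 4 * w v \<le> 1}"

definition worth :: "nat set \<Rightarrow> real" where
  "worth S = (\<Sum>u\<in>S. c u + (\<Sum>v\<in>S. b u v))"

text \<open>Only small neighbours count, because only they can be added to a greedy prefix later.\<close>
definition degree :: "nat \<Rightarrow> real" where "degree u = c u + (\<Sum>v\<in>small. b u v)"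

text \<open>Ratios are compared by cross multiplication, the form that integer arithmetic can
  evaluate. Breaking ties by index makes this a linear order on the items, so consecutive prefixes
  differ by one item.\<close>

definition before :: "nat \<Rightarrow> nat \<Rightarrow> bool" where
  "before v u \<longleftrightarrow> w v * degree u < w u * degree v \<or> w v * degree u = w u * degree v \<and> v \<le> u"

definition prefix :: "nat \<Rightarrow> nat set" where "prefix u = {v \<in> small. before v u}"

section \<open>The order by ratio and its prefixes\<close>

lemma finite_small [simp]: "finite small"
  by (simp add: small_def)

lemma finite_prefix [simp]: "finite (prefix u)"
  by (simp add: prefix_def)

lemma degree_pos: "u < n \<Longrightarrow> 0 < degree u"
  unfolding degree_def by (intro add_pos_nonneg c_pos sum_nonneg b_nonneg)

text \<open>Dividing by the positive degrees exposes a lexicographic order, from which transitivity,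
  antisymmetry and linearity are immediate.\<close>

lemma before_iff:
  assumes "u < n" "v < n"
  shows "before v u \<longleftrightarrow>
    w v / degree v < w u / degree u \<or> w v / degree v = w u / degree u \<and> v \<le> u"
  using degree_pos[OF assms(1)] degree_pos[OF assms(2)]
  by (simp add: before_def field_simps)

lemma before_trans:
  assumes "before x y" "before y z" "x < n" "y < n" "z < n"
  shows "before x z"
  using assms(1,2) unfolding before_iff[OF assms(4,3)] before_iff[OF assms(5,4)] before_iff[OF assms(5,3)]
  by (elim disjE) auto

lemma before_antisym:
  assumes "before x y" "before y x" "x < n" "y < n"
  shows "x = y"
  using assms by (auto simp: before_iff)

lemma before_linear:
  assumes "x < n" "y < n"
  shows "before x y \<or> before y x"
  using assms by (auto simp: before_iff)

text \<open>Take the prefix with the most items among those of weight at most 1/2. If a small item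
  is left, the next one in the order would push the weight above 1/2, yet it weighs at most 1/4
  itself.\<close>

lemma ex_heavy_prefix:
  assumes "small \<noteq> {}"
  obtains u where "u \<in> small" "sum w (prefix u) \<le> 1/2"
    "prefix u = small \<or> 1/4 \<le> sum w (prefix u)"
proof -
  define E where "E = {u \<in> small. sum w (prefix u) \<le> 1/2}"
  have lt: "u < n" if "u \<in> small" for u using that by (simp add: small_def)
  \<comment> \<open>Every nonempty set of small items has a first element: a strictly earlier item
    has a strictly smaller prefix, so an item of least prefix cardinality is first.\<close>
  have cases: "\<exists>v \<in> U. \<forall>z \<in> U. before z v \<longrightarrow> z = v" if "U \<subseteq> small" "U \<noteq> {}" for U
  proof -
    obtain v where v: "v \<in> U" "\<And>z. z \<in> U \<Longrightarrow> card (prefix v) \<le> card (prefix z)"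
      using \<open>U \<noteq> {}\<close> ex_has_least_nat[of "\<lambda>z. z \<in> U" _ "\<lambda>z. card (prefix z)"] by blast
    have "z = v" if z: "z \<in> U" "before z v" for z
    proof (rule ccontr)
      assume "z \<noteq> v"
      have "prefix z \<subset> prefix v"
      proof
        have zv: "z \<in> small" "v \<in> small" using z(1) v(1) \<open>U \<subseteq> small\<close> by auto
        show "prefix z \<subseteq> prefix v"
          using before_trans[OF _ z(2)] zv lt by (auto simp: prefix_def)
        have "v \<in> prefix v" using zv by (auto simp: prefix_def before_def)
        moreover have "v \<notin> prefix z"
          using before_antisym[OF _ z(2)] zv lt \<open>z \<noteq> v\<close> by (auto simp: prefix_def)
        ultimately show "prefix z \<noteq> prefix v" by blast
      qed
      then have "card (prefix z) < card (prefix v)" by (intro psubset_card_mono) auto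
      with v(2)[OF z(1)] show False by simp
    qed
    then show ?thesis using v(1) by blast
  qed
  \<comment> \<open>The prefix of the very first small item is that item alone, of weight at most
    1/4.\<close>
  have "E \<noteq> {}"
  proof -
    obtain v where v: "v \<in> small" "\<forall>z \<in> small. before z v \<longrightarrow> z = v"
      using cases[of small] assms by auto
    have "prefix v \<subseteq> {v}" using v by (auto simp: prefix_def)
    then have "sum w (prefix v) \<le> sum w {v}" by (intro sum_mono2) (auto simp: w_nonneg)
    then show ?thesis using v(1) by (auto simp: E_def small_def)
  qed
  have "card (prefix z) \<le> card small" for z by (intro card_mono) (auto simp: prefix_def)
  then obtain u where u: "u \<in> E" "\<And>z. z \<in> E \<Longrightarrow> card (prefix z) \<le> card (prefix u)"
    using \<open>E \<noteq> {}\<close>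
      ex_has_greatest_nat[of "\<lambda>z. z \<in> E" _ "\<lambda>z. card (prefix z)" "Suc (card small)"]
    by (metis all_not_in_conv le_imp_less_Suc)
  have us: "u \<in> small" "sum w (prefix u) \<le> 1/2" using u(1) by (auto simp: E_def)
  have "prefix u = small \<or> 1/4 \<le> sum w (prefix u)"
  proof (cases "prefix u = small")
    case False
    then have "small - prefix u \<noteq> {}" by (auto simp: prefix_def)
    \<comment> \<open>\<open>v\<close> is the next item after the prefix: everything before it lies
      in \<open>prefix u\<close>, so its own prefix adds nothing but \<open>v\<close>.\<close>
    then obtain v where v: "v \<in> small" "v \<notin> prefix u"
      "\<And>z. z \<in> small - prefix u \<Longrightarrow> before z v \<Longrightarrow> z = v"
      using cases[of "small - prefix u"] by auto
    have "before u v" using v(1,2) us(1) before_linear[of u v] lt by (auto simp: prefix_def)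
    then have "prefix u \<subseteq> prefix v"
      using before_trans[of _ u v] us(1) v(1) lt by (auto simp: prefix_def)
    moreover have "v \<in> prefix v" using v(1) by (auto simp: prefix_def before_def)
    ultimately have "prefix u \<subset> prefix v" using v(2) by blast
    then have "card (prefix u) < card (prefix v)" by (intro psubset_card_mono) auto
    with u(2) have "v \<notin> E" by force
    with v(1) have "1/2 < sum w (prefix v)" by (simp add: E_def)
    also have "\<dots> \<le> sum w (insert v (prefix u))"
      using v(3) by (intro sum_mono2) (auto simp: w_nonneg prefix_def)
    also have "\<dots> = w v + sum w (prefix u)" using v(2) by simp
    finally show ?thesis using v(1) by (simp add: small_def)
  qed auto
  with us show ?thesis using that by blast
qed

text \<open>Among the small items, those outside a greedy prefix have a worse degree-to-weight ratio than
  those inside, and the prefix already carries a quarter of the capacity.\<close>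
lemma degree_small_le_prefix:
  assumes u: "u \<in> small" and "prefix u = small \<or> 1/4 \<le> sum w (prefix u)"
    and "S \<subseteq> small" "sum w S \<le> P" "1 \<le> P"
  shows "sum degree S \<le> 5 * P * sum degree (prefix u)"
proof -
  have fS: "finite S" using finite_subset[OF assms(3)] by simp
  have dpos: "0 \<le> degree v" if "v \<in> small" for v
    using degree_pos[of v] that by (simp add: small_def)
  have p0: "0 \<le> sum degree (prefix u)" by (intro sum_nonneg dpos) (auto simp: prefix_def)
  have inside: "sum degree (S \<inter> prefix u) \<le> sum degree (prefix u)"
    by (intro sum_mono2) (auto simp: prefix_def dpos)
  have outside: "sum degree (S - prefix u) \<le> 4 * P * sum degree (prefix u)"
  proof (cases "prefix u = small")
    case True
    then have "S - prefix u = {}" using assms(3) by auto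
    then show ?thesis using p0 assms(5) by (simp only: sum.empty) simp
  next
    case False
    then have q: "1/4 \<le> sum w (prefix u)" using assms(2) by auto
    have ord: "w x * degree z \<le> w z * degree x" if "x \<in> prefix u" "z \<in> S - prefix u" for x z
    proof -
      have zs: "z \<in> small" "x \<in> small" using that assms(3) by (auto simp: prefix_def)
      then have lt: "x < n" "z < n" "u < n" using u by (auto simp: small_def)
      have "before x u" "\<not> before z u" using that zs by (auto simp: prefix_def)
      then have "w x / degree x \<le> w z / degree z" by (auto simp: before_iff lt)
      then show ?thesis using degree_pos[OF lt(1)] degree_pos[OF lt(2)] by (simp add: field_simps)
    qed
    \<comment> \<open>Exchange argument: multiply out, compare term by term with \<open>ord\<close>,
      and factor again.\<close>
    have "sum degree (S - prefix u) * sum w (prefix u) =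
        (\<Sum>z\<in>S - prefix u. \<Sum>x\<in>prefix u. w x * degree z)"
      by (simp add: sum_product mult.commute[of "degree _"])
    also have "\<dots> \<le> (\<Sum>z\<in>S - prefix u. \<Sum>x\<in>prefix u. w z * degree x)"
      by (intro sum_mono ord)
    also have "\<dots> = sum w (S - prefix u) * sum degree (prefix u)"
      by (simp add: sum_product)
    also have "\<dots> \<le> P * sum degree (prefix u)"
    proof (intro mult_right_mono p0)
      have "sum w (S - prefix u) \<le> sum w S" using fS by (intro sum_mono2) (auto simp: w_nonneg)
      then show "sum w (S - prefix u) \<le> P" using assms(4) by simp
    qed
    finally have 1: "sum degree (S - prefix u) * sum w (prefix u) \<le> P * sum degree (prefix u)" .
    have "0 \<le> sum degree (S - prefix u)" using assms(3) by (intro sum_nonneg dpos) auto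
    from mult_left_mono[OF q this] 1 show ?thesis by simp
  qed
  have "sum degree S = sum degree (S \<inter> prefix u) + sum degree (S - prefix u)"
    using sum.Int_Diff[OF fS] .
  also have "\<dots> \<le> (1 + 4 * P) * sum degree (prefix u)" using inside outside by (simp add: algebra_simps)
  also have "\<dots> \<le> 5 * P * sum degree (prefix u)" using assms(5) p0 by (intro mult_right_mono) auto
  finally show ?thesis .
qed

text \<open>Small items have weight at most one quarter, so cutting off maximal intervals of weight at most
  one half from the right uses up at least one quarter of the weight each time.\<close>
lemma sum_small_le_intervals:
  assumes g: "\<And>v. 0 \<le> (g v :: real)" and G: "0 \<le> G"
    and interval: "\<And>x y. y \<le> n \<Longrightarrow> sum w ({x..<y} \<inter> small) \<le> 1/2 \<Longrightarrow> sum g ({x..<y} \<inter> small) \<le> G"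
    and "y \<le> n"
  shows "sum g ({..<y} \<inter> small) \<le> (4 * sum w ({..<y} \<inter> small) + 1) * G"
  using \<open>y \<le> n\<close>
proof (induction y rule: less_induct)
  case (less y)
  have w0: "0 \<le> sum w U" for U by (intro sum_nonneg w_nonneg)
  show ?case
  proof (cases "sum w ({..<y} \<inter> small) \<le> 1/2")
    case True
    then have "sum g ({..<y} \<inter> small) \<le> G"
      using interval[of y 0] less.prems by (simp add: lessThan_atLeast0)
    \<comment> \<open>The summand 1 pays for the leftmost interval, whose weight has no useful lower
      bound.\<close>
    also have "\<dots> \<le> (4 * sum w ({..<y} \<inter> small) + 1) * G"
      using mult_right_mono[OF _ G, of 1] w0[of "{..<y} \<inter> small"] by simp
    finally show ?thesis .
  next
    case False
    define x where "x = (LEAST x. sum w ({x..<y} \<inter> small) \<le> 1/2)"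
    have x: "sum w ({x..<y} \<inter> small) \<le> 1/2"
      unfolding x_def by (rule LeastI[of _ y]) simp
    have "x \<noteq> 0" using False x by (metis lessThan_atLeast0)
    then obtain x' where x': "x = Suc x'" by (cases x) auto
    have big: "1/2 < sum w ({x'..<y} \<inter> small)"
      using not_less_Least[of x' "\<lambda>x. sum w ({x..<y} \<inter> small) \<le> 1/2"] x' by (simp add: x_def)
    then have "x' < y" by (cases "x' < y") auto
    have "{x'..<y} \<inter> small \<subseteq> {x..<y} \<inter> small \<union> ({x'} \<inter> small)"
      using x' by auto
    then have "sum w ({x'..<y} \<inter> small) \<le> sum w ({x..<y} \<inter> small \<union> ({x'} \<inter> small))"
      by (intro sum_mono2) (auto simp: w_nonneg)
    also have "\<dots> = sum w ({x..<y} \<inter> small) + sum w ({x'} \<inter> small)"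
      using x' by (intro sum.union_disjoint) auto
    also have "sum w ({x'} \<inter> small) \<le> 1/4"
      by (cases "x' \<in> small") (auto simp: small_def)
    finally have q: "1/4 \<le> sum w ({x..<y} \<inter> small)" using big by simp
    then have "x < y" using not_le by fastforce
    have split: "{..<y} \<inter> small = ({..<x} \<inter> small) \<union> ({x..<y} \<inter> small)"
      using \<open>x < y\<close> by auto
    have sp: "sum f ({..<y} \<inter> small) = sum f ({..<x} \<inter> small) + sum f ({x..<y} \<inter> small)"
      for f :: "nat \<Rightarrow> real"
      unfolding split by (rule sum.union_disjoint) auto
    have "sum g ({..<y} \<inter> small) \<le> (4 * sum w ({..<x} \<inter> small) + 1) * G + 1 * G"
      unfolding sp[of g] using less.IH[OF \<open>x < y\<close>] interval[OF less.prems x] \<open>x < y\<close> less.prems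
      by linarith
    also have "\<dots> \<le> (4 * sum w ({..<x} \<inter> small) + 1) * G + 4 * sum w ({x..<y} \<inter> small) * G"
      using q by (intro add_left_mono mult_right_mono G) auto
    also have "\<dots> = (4 * sum w ({..<y} \<inter> small) + 1) * G"
      unfolding sp[of w] by (simp add: algebra_simps)
    finally show ?thesis .
  qed
qed

text \<open>The capacity is 1 for the solution to be found and \<open>P\<close> for the solution \<open>S\<close> to compare with.
  If there are large items, then \<open>n \<le> 4 P R\<close>, so that pairs of items suffice for them.\<close>
theorem worth_le_best_candidate:
  assumes P: "1 \<le> P" and R: "1 \<le> R" and G: "0 \<le> G"
    and w_each: "\<And>v. v < n \<Longrightarrow> real n * w v \<le> P * R"
    and S: "S \<subseteq> {..<n}" "sum w S \<le> P"
    and pairs: "\<And>u v. u \<in> S \<Longrightarrow> v \<in> S \<Longrightarrow> worth {u, v} \<le> G"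
    and greedy: "\<And>u x y. u \<in> small \<Longrightarrow> y \<le> n \<Longrightarrow>
      sum w (prefix u \<union> ({x..<y} \<inter> small)) \<le> 1 \<Longrightarrow> worth (prefix u \<union> ({x..<y} \<inter> small)) \<le> G"
  shows "worth S \<le> 78 * P\<^sup>2 * R * G"
proof -
  have fS: "finite S" using S(1) finite_subset by auto
  define M L where "M = S \<inter> small" and "L = S - small"
  have split: "sum f S = sum f M + sum f L" for f :: "nat \<Rightarrow> real"
    unfolding M_def L_def by (rule sum.Int_Diff[OF fS])
  have c0: "0 \<le> c v" if "v \<in> S" for v using c_pos[of v] that S(1) by auto
  have pair_b: "b u v \<le> G" and pair_c: "c u \<le> G" if "u \<in> S" "v \<in> S" for u v
  proof -
    have "c u + b u v \<le> c u + (\<Sum>v\<in>{u,v}. b u v)"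
      using member_le_sum[of v "{u,v}" "b u"] b_nonneg by auto
    also have "\<dots> \<le> worth {u, v}"
      unfolding worth_def
      using member_le_sum[of u "{u,v}" "\<lambda>u'. c u' + (\<Sum>v\<in>{u,v}. b u' v)"] that
      by (auto intro!: add_nonneg_nonneg c0 sum_nonneg b_nonneg)
    finally have *: "c u + b u v \<le> G" using pairs[OF that] by simp
    then show "b u v \<le> G" using c0[OF that(1)] by simp
    show "c u \<le> G" using * b_nonneg[of u v] by simp
  qed
  have PR0: "0 \<le> P\<^sup>2 * R * G" using P R G by simp

  have small_part: "sum degree M \<le> 30 * P\<^sup>2 * R * G"
  proof (cases "small = {}")
    case True
    then show ?thesis using PR0 by (simp add: M_def mult_ac)
  next
    case False
    obtain u where u: "u \<in> small" "sum w (prefix u) \<le> 1/2"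
      "prefix u = small \<or> 1/4 \<le> sum w (prefix u)"
      using ex_heavy_prefix[OF False] .
    let ?H = "prefix u"
    have Hn: "?H \<subseteq> small" "?H \<subseteq> {..<n}" by (auto simp: prefix_def small_def)
    \<comment> \<open>\<open>g v\<close> is what \<open>v\<close> contributes in products with the
      prefix; summed over all small \<open>v\<close> it is the quadratic part of the degrees of the
      prefix.\<close>
    define g where "g v = (\<Sum>x\<in>?H. b x v)" for v
    have cand: "sum g ({x..<y} \<inter> small) \<le> G \<and> sum c ?H \<le> G"
      if xy: "y \<le> n" "sum w ({x..<y} \<inter> small) \<le> 1/2" for x y
    proof -
      let ?T = "{x..<y} \<inter> small"
      have "sum w (?H \<union> ?T) \<le> sum w ?H + sum w ?T"
        by (simp add: sum_Un sum_nonneg w_nonneg)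
      then have "worth (?H \<union> ?T) \<le> G" using u xy by (intro greedy) auto
      moreover have "sum g ?T + sum c ?H \<le> worth (?H \<union> ?T)"
      proof -
        \<comment> \<open>Only the linear terms of the prefix and the products from the prefix into
          the interval are kept. An overlap of the two sets is harmless, because
          \<open>worth\<close> sums over their union.\<close>
        have "sum g ?T + sum c ?H = (\<Sum>x\<in>?H. c x + (\<Sum>v\<in>?T. b x v))"
          unfolding g_def by (subst sum.swap) (simp add: sum.distrib)
        also have "\<dots> \<le> (\<Sum>x\<in>?H. c x + (\<Sum>v\<in>?H \<union> ?T. b x v))"
          by (intro sum_mono add_left_mono sum_mono2) (auto simp: b_nonneg)
        also have "\<dots> \<le> worth (?H \<union> ?T)"
          unfolding worth_def
          by (intro sum_mono2)
             (auto intro!: add_nonneg_nonneg sum_nonneg b_nonneg less_imp_le[OF c_pos] simp: small_def)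
        finally show ?thesis .
      qed
      moreover have "0 \<le> sum g ?T" by (auto simp: g_def intro!: sum_nonneg b_nonneg)
      moreover have "0 \<le> sum c ?H" using Hn by (auto intro!: sum_nonneg less_imp_le[OF c_pos])
      ultimately show ?thesis by linarith
    qed
    have W: "sum w small \<le> P * R"
    proof -
      have "sum w small \<le> (\<Sum>v<n. P * R / n)"
        using w_each w_nonneg
        by (intro order_trans[OF sum_mono2 sum_mono]) (auto simp: small_def field_simps)
      also have "\<dots> \<le> P * R" using P R by simp
      finally show ?thesis .
    qed
    have nsm: "{..<n} \<inter> small = small" by (auto simp: small_def)
    have "sum g small \<le> (4 * sum w small + 1) * G"
      using sum_small_le_intervals[of g G n] cand G
      by (auto simp: nsm g_def intro!: sum_nonneg b_nonneg)
    also have "\<dots> \<le> (4 * (P * R) + 1) * G" using W G by (intro mult_right_mono) auto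
    finally have gs: "sum g small \<le> (4 * (P * R) + 1) * G" .
    have "sum degree ?H = sum g small + sum c ?H"
      unfolding degree_def g_def by (simp add: sum.distrib sum.swap[of _ small])
    also have "\<dots> \<le> (4 * (P * R) + 1) * G + 1 * G" using gs cand[of 0 0] by simp
    also have "\<dots> = (4 * (P * R) + 2) * G" by (simp add: algebra_simps)
    \<comment> \<open>The 2 is absorbed by \<open>1 \<le> P * R\<close>.\<close>
    also have "\<dots> \<le> 6 * (P * R) * G"
      using mult_mono[OF P R] P R by (intro mult_right_mono G) auto
    finally have H: "sum degree ?H \<le> 6 * (P * R) * G" .
    have "sum w M \<le> P"
      using S(2) fS sum_mono2[of S M w] w_nonneg by (force simp: M_def)
    then have "sum degree M \<le> 5 * P * sum degree ?H"
      using degree_small_le_prefix[OF u(1,3), of M P] P by (auto simp: M_def)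
    also have "\<dots> \<le> 5 * P * (6 * (P * R) * G)" using H P by (intro mult_left_mono) auto
    finally show ?thesis by (simp add: power2_eq_square mult_ac)
  qed

  \<comment> \<open>Both orders of the indices are counted, since \<open>b\<close> is not assumed
    symmetric. There are at most \<open>4 * P\<close> large items, each contributes at most
    \<open>3 * n * G\<close> through pairs, and \<open>n \<le> 4 * (P * R)\<close>; this gives the
    factor 48.\<close>
  have large_part: "(\<Sum>l\<in>L. c l + (\<Sum>v\<in>S. b l v + b v l)) \<le> 48 * P\<^sup>2 * R * G"
  proof (cases "L = {}")
    case True
    then show ?thesis using PR0 by (simp add: mult_ac)
  next
    case False
    then obtain l where l: "l \<in> L" by auto
    then have ln: "l < n" "1/4 < w l" using S(1) by (auto simp: L_def small_def)
    have wl: "1/4 \<le> w l" if "l \<in> L" for l using that S(1) by (auto simp: L_def small_def)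
    have "real n * (1/4) \<le> real n * w l" using ln by (intro mult_left_mono) auto
    then have n: "real n \<le> 4 * (P * R)" using w_each[OF ln(1)] by simp
    have n1: "1 \<le> real n" using ln by simp
    have "(\<Sum>l\<in>L. 1/4) \<le> sum w L" by (intro sum_mono wl)
    also have "\<dots> \<le> sum w S" using fS by (intro sum_mono2) (auto simp: L_def w_nonneg)
    finally have cL: "real (card L) \<le> 4 * P" using S(2) by simp
    have "card S \<le> n" using card_mono[OF _ S(1)] by simp
    have "c l + (\<Sum>v\<in>S. b l v + b v l) \<le> 3 * real n * G" if "l \<in> L" for l
    proof -
      have lS: "l \<in> S" using that by (simp add: L_def)
      have "b l v + b v l \<le> 2 * G" if "v \<in> S" for v
        using pair_b[OF lS that] pair_b[OF that lS] by simp
      then have "(\<Sum>v\<in>S. b l v + b v l) \<le> (\<Sum>v\<in>S. 2 * G)" by (rule sum_mono)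
      also have "\<dots> \<le> 2 * n * G" using \<open>card S \<le> n\<close> G by (simp add: mult_right_mono)
      finally show ?thesis using pair_c[OF lS lS] mult_right_mono[OF n1 G] by simp
    qed
    then have "(\<Sum>l\<in>L. c l + (\<Sum>v\<in>S. b l v + b v l)) \<le> card L * (3 * real n * G)"
      by (intro sum_bounded_above) auto
    also have "\<dots> \<le> (4 * P) * (3 * (4 * (P * R)) * G)"
      using cL n G P R by (intro mult_mono) auto
    finally show ?thesis by (simp add: power2_eq_square mult_ac)
  qed

  \<comment> \<open>Index pairs are split into small-small, small-large and large-arbitrary; the
    last two kinds are covered by \<open>large_part\<close>.\<close>
  have "worth S = (\<Sum>u\<in>M. c u + (\<Sum>v\<in>M. b u v)) + (\<Sum>u\<in>M. \<Sum>v\<in>L. b u v)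
      + (\<Sum>u\<in>L. c u + (\<Sum>v\<in>S. b u v))"
    unfolding worth_def split[of "\<lambda>u. c u + _ u"] by (simp add: split sum.distrib)
  also have "(\<Sum>u\<in>M. c u + (\<Sum>v\<in>M. b u v)) \<le> sum degree M"
    unfolding degree_def by (intro sum_mono add_left_mono sum_mono2) (auto simp: M_def b_nonneg)
  also have "(\<Sum>u\<in>M. \<Sum>v\<in>L. b u v) \<le> (\<Sum>l\<in>L. \<Sum>v\<in>S. b v l)"
    by (subst sum.swap, intro sum_mono sum_mono2) (auto simp: M_def b_nonneg fS)
  finally have "worth S \<le> sum degree M + (\<Sum>l\<in>L. c l + (\<Sum>v\<in>S. b l v + b v l))"
    by (simp add: sum.distrib)
  then show ?thesis using small_part large_part by simp
qed

end

section \<open>Bounded runs of deterministic programs\<close>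

text \<open>Runs without coin flips, with the number of steps, in which no stored value exceeds \<open>Z\<close>. Since
  the size of every expression is fixed by the program, the cost of a step is then linear in the
  length of \<open>Z\<close>, and it suffices to count steps.\<close>
inductive reaches :: "nat \<Rightarrow> com \<Rightarrow> mem \<Rightarrow> nat \<Rightarrow> mem \<Rightarrow> bool" for Z where
  Skip: "reaches Z Skip s 1 s"
| Assign: "val e s \<le> Z \<Longrightarrow> reaches Z (Assign x i e) s 1 (store x (val i s) (val e s) s)"
| Seq: "reaches Z c1 s m1 s1 \<Longrightarrow> reaches Z c2 s1 m2 s2 \<Longrightarrow> reaches Z (Seq c1 c2) s (m1 + m2) s2"
| If_True: "val e s \<noteq> 0 \<Longrightarrow> reaches Z c1 s m s1 \<Longrightarrow> reaches Z (If e c1 c2) s (m + 1) s1"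
| If_False: "val e s = 0 \<Longrightarrow> reaches Z c2 s m s1 \<Longrightarrow> reaches Z (If e c1 c2) s (m + 1) s1"
| While_False: "val e s = 0 \<Longrightarrow> reaches Z (While e c) s 1 s"
| While_True: "val e s \<noteq> 0 \<Longrightarrow> reaches Z c s m1 s1 \<Longrightarrow> reaches Z (While e c) s1 m2 s2 \<Longrightarrow>
    reaches Z (While e c) s (m1 + m2 + 1) s2"

primrec written :: "com \<Rightarrow> string set" where
  "written Skip = {}"
| "written (Assign x i e) = {x}"
| "written (Flip x i) = {x}"
| "written (Seq c1 c2) = written c1 \<union> written c2"
| "written (If e c1 c2) = written c1 \<union> written c2"
| "written (While e c) = written c"

primrec expr_size :: "expr \<Rightarrow> nat" where
  "expr_size (Const k) = 1 + bits k"
| "expr_size (Read x e) = 1 + expr_size e"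
| "expr_size (Op f e1 e2) = 1 + expr_size e1 + expr_size e2"

text \<open>The squares arise because an expression pays for a value length at each of its nodes,
  and these lengths are themselves linear in the size of the subexpression.\<close>

primrec com_size :: "com \<Rightarrow> nat" where
  "com_size Skip = 1"
| "com_size (Assign x i e) = 1 + (expr_size i)\<^sup>2 + (expr_size e)\<^sup>2"
| "com_size (Flip x i) = 1 + (expr_size i)\<^sup>2"
| "com_size (Seq c1 c2) = com_size c1 + com_size c2"
| "com_size (If e c1 c2) = 1 + (expr_size e)\<^sup>2 + com_size c1 + com_size c2"
| "com_size (While e c) = 1 + (expr_size e)\<^sup>2 + com_size c"

definition cells_le :: "nat \<Rightarrow> mem \<Rightarrow> bool" where
  "cells_le Z s \<longleftrightarrow> (\<forall>x k. s x k \<le> Z)"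

section \<open>Value lengths and costs in bounded runs\<close>

lemma reaches_frame: "reaches Z c s m s' \<Longrightarrow> x \<notin> written c \<Longrightarrow> s' x = s x"
  by (induction rule: reaches.induct) (auto simp: store_def)

lemma reaches_cells_le: "reaches Z c s m s' \<Longrightarrow> cells_le Z s \<Longrightarrow> cells_le Z s'"
  by (induction rule: reaches.induct) (auto simp: store_def cells_le_def)

lemma bits_mono: "a \<le> b \<Longrightarrow> bits a \<le> bits b"
  by (rule floorlog_mono)

lemma less_two_power_bits: "a < 2 ^ bits a"
  by (simp add: floorlog_leD[OF order_refl])

lemma bits_le_iff: "bits a \<le> k \<longleftrightarrow> a < 2 ^ k"
  by (simp add: floorlog_le_iff)

text \<open>Multiplication adds lengths, and every other operation stays below \<open>a + b\<close>,
  which costs one extra bit. Hence value lengths grow only linearly with the expression.\<close>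

lemma bits_opval: "bits (opval f a b) \<le> 1 + bits a + bits b"
proof -
  have ab: "a < 2 ^ bits a" "b < 2 ^ bits b" by (rule less_two_power_bits)+
  have le: "2 ^ bits a \<le> (2::nat) ^ (bits a + bits b)" "2 ^ bits b \<le> (2::nat) ^ (bits a + bits b)"
    by (simp_all add: power_increasing)
  have "a * b < 2 ^ (bits a + bits b)"
    unfolding power_add using ab by (intro mult_strict_mono) auto
  moreover have "opval f a b \<le> a + b \<or> opval f a b = a * b"
    using mod_less_eq_dividend[of a b] div_le_dividend[of a b]
    by (cases f) (auto intro: trans_le_add1 simp del: mod_less_eq_dividend div_le_dividend)
  ultimately have "opval f a b < 2 * 2 ^ (bits a + bits b)"
    using ab le by linarith
  then show ?thesis by (simp add: bits_le_iff)
qed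

lemma bits_val_le:
  assumes "cells_le Z s"
  shows "bits (val e s) \<le> expr_size e * (bits Z + 1)"
proof (induction e)
  case (Op f e1 e2)
  then show ?case using bits_opval[of f "val e1 s" "val e2 s"] by (simp add: algebra_simps)
next
  case (Read x e)
  have "bits (s x (val e s)) \<le> bits Z" using assms by (intro bits_mono) (simp add: cells_le_def)
  then show ?case by simp
qed simp

lemma cost_le:
  assumes "cells_le Z s"
  shows "cost e s \<le> (expr_size e)\<^sup>2 * (bits Z + 2)"
proof (induction e)
  case (Const k)
  have "1 + bits k \<le> (1 + bits k)\<^sup>2" by (simp add: power2_eq_square)
  then have "(1 + bits k) * 1 \<le> (1 + bits k)\<^sup>2 * (bits Z + 2)" by (intro mult_mono) auto
  then show ?case by simp
next
  case (Read x e)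
  have b: "bits (val (Read x e) s) \<le> bits Z" using assms by (auto intro!: bits_mono simp: cells_le_def)
  have "cost (Read x e) s \<le> ((expr_size e)\<^sup>2 + 1) * (bits Z + 2)" using b Read by simp
  also have "\<dots> \<le> (expr_size (Read x e))\<^sup>2 * (bits Z + 2)"
    by (intro mult_right_mono) (auto simp: power2_eq_square)
  finally show ?case .
next
  case (Op f e1 e2)
  have "cost (Op f e1 e2) s \<le>
      1 + (expr_size e1)\<^sup>2 * (bits Z + 2) + (expr_size e2)\<^sup>2 * (bits Z + 2) + expr_size (Op f e1 e2) * (bits Z + 1)"
    using Op bits_val_le[OF assms, of "Op f e1 e2"] by simp
  also have "\<dots> \<le> ((expr_size e1)\<^sup>2 + (expr_size e2)\<^sup>2 + (1 + expr_size e1 + expr_size e2)) * (bits Z + 2)"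
    by (simp add: algebra_simps)
  also have "\<dots> \<le> (expr_size (Op f e1 e2))\<^sup>2 * (bits Z + 2)"
    by (intro mult_right_mono) (auto simp: power2_eq_square algebra_simps)
  finally show ?case .
qed

lemma exec_While:
  "exec (While e c) (s, t) =
     (if val e s \<noteq> 0 then bind_spmf (exec c (s, t + 1 + cost e s)) (exec (While e c))
      else return_spmf (s, t + 1 + cost e s))"
  by (simp add: loop.simps[of e "exec c" "(s, t)"] Let_def)

text \<open>No rule of \<open>reaches\<close> covers \<open>Flip\<close>, so the run is
  deterministic and \<open>exec\<close> yields a point mass; termination is inherited from the
  finite derivation. The elapsed time enters \<open>exec\<close> only additively, which is why one
  \<open>k\<close> serves every \<open>t\<close>.\<close>

lemma reaches_exec:
  assumes "reaches Z c s m s'" "cells_le Z s"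
  shows "\<exists>k \<le> m * com_size c * (bits Z + 2). \<forall>t. exec c (s, t) = return_spmf (s', t + k)"
  using assms
proof (induction rule: reaches.induct)
  case (Skip s)
  then show ?case by (intro exI[of _ 1]) auto
next
  case (Assign e s x i)
  then show ?case using cost_le[of Z s e] cost_le[of Z s i]
    by (intro exI[of _ "1 + cost i s + cost e s"]) (auto simp: algebra_simps)
next
  case (Seq c1 s m1 s1 c2 m2 s2)
  then obtain k1 k2 where
    k: "k1 \<le> m1 * com_size c1 * (bits Z + 2)" "k2 \<le> m2 * com_size c2 * (bits Z + 2)"
      "\<And>t. exec c1 (s, t) = return_spmf (s1, t + k1)" "\<And>t. exec c2 (s1, t) = return_spmf (s2, t + k2)"
    using reaches_cells_le by blast
  have "k1 + k2 \<le> m1 * com_size c1 * (bits Z + 2) + m2 * com_size c2 * (bits Z + 2)" using k by simp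
  also have "\<dots> \<le> (m1 + m2) * com_size (Seq c1 c2) * (bits Z + 2)" by (simp add: algebra_simps)
  finally show ?case using k by (intro exI[of _ "k1 + k2"]) (auto simp: add.assoc)
next
  case (If_True e s c1 m s1 c2)
  then obtain k where
    k: "k \<le> m * com_size c1 * (bits Z + 2)" "\<And>t. exec c1 (s, t) = return_spmf (s1, t + k)"
    by blast
  have "1 + cost e s + k \<le> 1 + (expr_size e)\<^sup>2 * (bits Z + 2) + m * com_size c1 * (bits Z + 2)"
    using k cost_le[OF If_True.prems, of e] by simp
  also have "\<dots> \<le> (m + 1) * com_size (If e c1 c2) * (bits Z + 2)" by (simp add: algebra_simps)
  finally show ?case using k If_True.hyps by (intro exI[of _ "1 + cost e s + k"]) (auto simp: add.assoc)
next
  case (If_False e s c2 m s1 c1)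
  then obtain k where
    k: "k \<le> m * com_size c2 * (bits Z + 2)" "\<And>t. exec c2 (s, t) = return_spmf (s1, t + k)"
    by blast
  have "1 + cost e s + k \<le> 1 + (expr_size e)\<^sup>2 * (bits Z + 2) + m * com_size c2 * (bits Z + 2)"
    using k cost_le[OF If_False.prems, of e] by simp
  also have "\<dots> \<le> (m + 1) * com_size (If e c1 c2) * (bits Z + 2)" by (simp add: algebra_simps)
  finally show ?case using k If_False.hyps by (intro exI[of _ "1 + cost e s + k"]) (auto simp: add.assoc)
next
  case (While_False e s c)
  then show ?case using cost_le[of Z s e]
    by (intro exI[of _ "1 + cost e s"]) (auto simp: exec_While algebra_simps simp del: exec.simps(6))
next
  case (While_True e s c m1 s1 m2 s2)
  let ?K = "com_size (While e c)"
  obtain k1 k2 where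
    k: "k1 \<le> m1 * com_size c * (bits Z + 2)" "k2 \<le> m2 * ?K * (bits Z + 2)"
      "\<And>t. exec c (s, t) = return_spmf (s1, t + k1)"
      "\<And>t. exec (While e c) (s1, t) = return_spmf (s2, t + k2)"
    using While_True reaches_cells_le by blast
  have "1 + cost e s + k1 + k2 \<le>
      1 + (expr_size e)\<^sup>2 * (bits Z + 2) + m1 * com_size c * (bits Z + 2) + m2 * ?K * (bits Z + 2)"
    using k cost_le[OF While_True.prems, of e] by simp
  also have "\<dots> \<le> (m1 + m2 + 1) * ?K * (bits Z + 2)" by (simp add: algebra_simps)
  finally show ?case using k While_True.hyps
    by (intro exI[of _ "1 + cost e s + k1 + k2"]) (auto simp: exec_While add.assoc simp del: exec.simps(6))
qed

text \<open>A total-correctness triple with a step budget, stated for a single initial memory so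
  that the postcondition can refer to that memory directly.\<close>

definition achieves :: "nat \<Rightarrow> com \<Rightarrow> mem \<Rightarrow> nat \<Rightarrow> (mem \<Rightarrow> bool) \<Rightarrow> bool" where
  "achieves Z c s M Q \<longleftrightarrow> (\<exists>m s'. m \<le> M \<and> reaches Z c s m s' \<and> Q s')"

lemma achieves_weaken:
  "achieves Z c s M Q \<Longrightarrow> M \<le> M' \<Longrightarrow> (\<And>s'. Q s' \<Longrightarrow> Q' s') \<Longrightarrow> achieves Z c s M' Q'"
  unfolding achieves_def by (meson order_trans)

lemma achieves_frame:
  "achieves Z c s M Q \<Longrightarrow>
    achieves Z c s M (\<lambda>s'. Q s' \<and> (\<forall>x. x \<notin> written c \<longrightarrow> s' x = s x))"
  unfolding achieves_def using reaches_frame by blast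

lemma achieves_Skip: "Q s \<Longrightarrow> achieves Z Skip s 1 Q"
  unfolding achieves_def using reaches.Skip by blast

lemma achieves_Assign:
  "val e s \<le> Z \<Longrightarrow> Q (store x (val i s) (val e s) s) \<Longrightarrow> achieves Z (Assign x i e) s 1 Q"
  unfolding achieves_def using reaches.Assign by blast

lemma achieves_Seq:
  "achieves Z c1 s M1 R \<Longrightarrow> (\<And>s'. R s' \<Longrightarrow> achieves Z c2 s' M2 Q) \<Longrightarrow>
    achieves Z (Seq c1 c2) s (M1 + M2) Q"
  unfolding achieves_def by (meson add_mono reaches.Seq)

lemma achieves_If:
  assumes "val e s \<noteq> 0 \<Longrightarrow> achieves Z c1 s M Q" "val e s = 0 \<Longrightarrow> achieves Z c2 s M Q"
  shows "achieves Z (If e c1 c2) s (M + 1) Q"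
proof (cases "val e s = 0")
  case True
  then show ?thesis
    using assms(2) reaches.If_False[of e s Z c2 _ _ c1] unfolding achieves_def
    by (metis add_mono order_refl)
next
  case False
  then show ?thesis
    using assms(1) reaches.If_True[of e s Z c1 _ _ c2] unfolding achieves_def
    by (metis add_mono order_refl)
qed

section \<open>Counting loops\<close>

abbreviation Var :: "string \<Rightarrow> expr" where "Var x \<equiv> Read x (Const 0)"

text \<open>Subtraction is truncated, so the guard is nonzero exactly while the counter is below
  \<open>e\<close>, which is evaluated anew in each round.\<close>

definition For :: "string \<Rightarrow> expr \<Rightarrow> com \<Rightarrow> com" where
  "For i e c = Seq (Assign i (Const 0) (Const 0))
     (While (Op Minus e (Var i)) (Seq c (Assign i (Const 0) (Op Plus (Var i) (Const 1)))))"

lemma written_For [simp]: "written (For i e c) = insert i (written c)"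
  by (auto simp: For_def)

text \<open>The invariant is required of the memory with the counter already advanced. A round
  consists of the guard, the body and the increment, hence \<open>M + 2\<close>; the final 2 steps
  are the initialisation and the failing guard.\<close>

lemma achieves_For:
  assumes step: "\<And>k s'. k < N \<Longrightarrow> J k s' \<Longrightarrow> s' i 0 = k \<Longrightarrow>
      achieves Z c s' M (\<lambda>s''. s'' i 0 = k \<and> J (Suc k) (store i 0 (Suc k) s''))"
    and init: "J 0 (store i 0 0 s)"
    and bound: "\<And>k s'. k \<le> N \<Longrightarrow> J k s' \<Longrightarrow> val e s' = N"
    and "N \<le> Z"
  shows "achieves Z (For i e c) s (N * (M + 2) + 2) (\<lambda>s'. s' i 0 = N \<and> J N s')"
proof -
  let ?c = "Seq c (Assign i (Const 0) (Op Plus (Var i) (Const 1)))"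
  let ?w = "While (Op Minus e (Var i)) ?c"
  have loop: "achieves Z ?w s' ((N - k) * (M + 2) + 1) (\<lambda>s'. s' i 0 = N \<and> J N s')"
    if "k \<le> N" "J k s'" "s' i 0 = k" for k s'
    using that
  proof (induction "N - k" arbitrary: k s')
    case 0
    then have "k = N" by simp
    then have "reaches Z ?w s' 1 s'" using 0 bound[of N s'] by (intro reaches.While_False) simp
    with 0 \<open>k = N\<close> show ?case unfolding achieves_def by auto
  next
    case (Suc d)
    then have k: "k < N" "d = N - Suc k" by auto
    have "achieves Z ?c s' (M + 1) (\<lambda>s'. J (Suc k) s' \<and> s' i 0 = Suc k)"
      using k \<open>N \<le> Z\<close>
      by (intro achieves_Seq[OF step[OF k(1) Suc.prems(2,3)]] achieves_Assign) (auto simp: store_def)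
    then obtain m1 s1 where 1: "m1 \<le> M + 1" "reaches Z ?c s' m1 s1" "J (Suc k) s1" "s1 i 0 = Suc k"
      unfolding achieves_def by auto
    obtain m2 s2 where 2: "m2 \<le> (N - Suc k) * (M + 2) + 1" "reaches Z ?w s1 m2 s2" "s2 i 0 = N" "J N s2"
      using Suc.hyps(1)[OF k(2) _ 1(3,4)] k unfolding achieves_def by auto
    have "val (Op Minus e (Var i)) s' \<noteq> 0" using k Suc.prems bound[of k s'] by simp
    from reaches.While_True[OF this 1(2) 2(2)] 
    have "reaches Z ?w s' (m1 + m2 + 1) s2" .
    moreover have "m1 + m2 + 1 \<le> (N - k) * (M + 2) + 1"
    proof -
      have "N - k = Suc (N - Suc k)" using k by simp
      then show ?thesis using 1(1) 2(1) by simp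
    qed
    ultimately show ?case using 2 unfolding achieves_def by blast
  qed
  have "achieves Z (Assign i (Const 0) (Const 0)) s 1 (\<lambda>s'. J 0 s' \<and> s' i 0 = 0)"
    using init by (intro achieves_Assign) (auto simp: store_def)
  then have "achieves Z (For i e c) s (1 + (N * (M + 2) + 1)) (\<lambda>s'. s' i 0 = N \<and> J N s')"
    unfolding For_def by (rule achieves_Seq) (use loop[of 0] in auto)
  then show ?thesis by simp
qed


definition eq_off :: "string set \<Rightarrow> mem \<Rightarrow> mem \<Rightarrow> bool" where
  "eq_off W s s' \<longleftrightarrow> (\<forall>x. x \<notin> W \<longrightarrow> s' x = s x)"

lemma eq_off_refl [simp]: "eq_off W s s"
  by (simp add: eq_off_def)

lemma achieves_eq_off:
  "achieves Z c s M Q \<Longrightarrow> achieves Z c s M (\<lambda>s'. Q s' \<and> eq_off (written c) s s')"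
  unfolding eq_off_def by (rule achieves_frame)

text \<open>The command \<open>c\<close> prepares scratch cells which \<open>e\<close> then reads;
  this is how nested sums are expressed.\<close>

definition Accum :: "string \<Rightarrow> string \<Rightarrow> expr \<Rightarrow> com \<Rightarrow> expr \<Rightarrow> com" where
  "Accum y i N c e = Seq (Assign y (Const 0) (Const 0))
     (For i N (Seq c (Assign y (Const 0) (Op Plus (Var y) e))))"

definition Fill :: "string \<Rightarrow> string \<Rightarrow> expr \<Rightarrow> com \<Rightarrow> expr \<Rightarrow> com" where
  "Fill y i N c e = For i N (Seq c (Assign y (Var i) e))"

lemma written_Accum [simp]: "written (Accum y i N c e) = insert y (insert i (written c))"
  by (auto simp: Accum_def)

lemma written_Fill [simp]: "written (Fill y i N c e) = insert y (insert i (written c))"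
  by (auto simp: Fill_def)

text \<open>The body is specified for every memory that agrees with \<open>s\<close> off the scratch
  arrays. So no invariant is left to the caller: it is always the partial sum together with this
  agreement.\<close>

lemma achieves_Accum:
  assumes "i \<noteq> y" "i \<notin> written c" "y \<notin> written c"
    and body: "\<And>k s'. k < n \<Longrightarrow> eq_off (insert y (insert i (written c))) s s' \<Longrightarrow> s' i 0 = k \<Longrightarrow>
      achieves Z c s' M (\<lambda>s''. val e s'' = f k)"
    and bound: "\<And>s'. eq_off (insert y (insert i (written c))) s s' \<Longrightarrow> val N s' = n"
    and "n \<le> Z" "(\<Sum>k<n. f k) \<le> Z"
  shows "achieves Z (Accum y i N c e) s (n * (M + 3) + 3)
    (\<lambda>s'. s' y 0 = (\<Sum>k<n. f k) \<and> eq_off (insert y (insert i (written c))) s s')"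
proof -
  let ?W = "insert y (insert i (written c))"
  let ?J = "\<lambda>k s'. s' y 0 = (\<Sum>j<k. f j) \<and> eq_off ?W s s'"
  have partial: "(\<Sum>j<k. f j) \<le> Z" if "k \<le> n" for k
    using sum_mono2[of "{..<n}" "{..<k}" f] that assms(7) by force
  have "achieves Z (Assign y (Const 0) (Const 0)) s 1 (?J 0)"
    by (intro achieves_Assign) (auto simp: store_def eq_off_def)
  moreover have "achieves Z (For i N (Seq c (Assign y (Const 0) (Op Plus (Var y) e)))) s'
      (n * ((M + 1) + 2) + 2) (\<lambda>s'. s' i 0 = n \<and> ?J n s')" if "?J 0 s'" for s'
  proof (rule achieves_For)
    fix k s1
    assume k: "k < n" and J: "?J k s1" and i: "s1 i 0 = k"
    show "achieves Z (Seq c (Assign y (Const 0) (Op Plus (Var y) e))) s1 (M + 1)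
       (\<lambda>s''. s'' i 0 = k \<and> ?J (Suc k) (store i 0 (Suc k) s''))"
    proof (rule achieves_Seq)
      show "achieves Z c s1 M (\<lambda>s''. val e s'' = f k \<and> eq_off (written c) s1 s'')"
        using body[of k s1] k i J by (intro achieves_eq_off) auto
    next
      fix s2
      assume s2: "val e s2 = f k \<and> eq_off (written c) s1 s2"
      then have "s2 y = s1 y" "s2 i = s1 i" using assms(2,3) by (auto simp: eq_off_def)
      moreover have "eq_off ?W s s2" using J s2 by (auto simp: eq_off_def)
      ultimately show "achieves Z (Assign y (Const 0) (Op Plus (Var y) e)) s2 1
          (\<lambda>s''. s'' i 0 = k \<and> ?J (Suc k) (store i 0 (Suc k) s''))"
        using s2 J i k partial[of "Suc k"] \<open>i \<noteq> y\<close>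
        by (intro achieves_Assign) (auto simp: store_def eq_off_def)
    qed
  qed (use that bound \<open>n \<le> Z\<close> \<open>i \<noteq> y\<close> in \<open>auto simp: store_def eq_off_def\<close>)
  ultimately have "achieves Z (Accum y i N c e) s (1 + (n * ((M + 1) + 2) + 2))
      (\<lambda>s'. s' i 0 = n \<and> ?J n s')"
    unfolding Accum_def by (rule achieves_Seq)
  then show ?thesis by (rule achieves_weaken) (auto simp: numeral_3_eq_3)
qed

lemma achieves_Fill:
  assumes "i \<noteq> y" "i \<notin> written c" "y \<notin> written c"
    and body: "\<And>k s'. k < n \<Longrightarrow> eq_off (insert y (insert i (written c))) s s' \<Longrightarrow> s' i 0 = k \<Longrightarrow>
      achieves Z c s' M (\<lambda>s''. val e s'' = f k)"
    and bound: "\<And>s'. eq_off (insert y (insert i (written c))) s s' \<Longrightarrow> val N s' = n"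
    and "n \<le> Z" and f: "\<And>k. k < n \<Longrightarrow> f k \<le> Z"
  shows "achieves Z (Fill y i N c e) s (n * (M + 3) + 2)
    (\<lambda>s'. (\<forall>k<n. s' y k = f k) \<and> eq_off (insert y (insert i (written c))) s s')"
proof -
  let ?W = "insert y (insert i (written c))"
  let ?J = "\<lambda>k s'. (\<forall>j<k. s' y j = f j) \<and> eq_off ?W s s'"
  have "achieves Z (For i N (Seq c (Assign y (Var i) e))) s
      (n * ((M + 1) + 2) + 2) (\<lambda>s'. s' i 0 = n \<and> ?J n s')"
  proof (rule achieves_For)
    fix k s1
    assume k: "k < n" and J: "?J k s1" and i: "s1 i 0 = k"
    show "achieves Z (Seq c (Assign y (Var i) e)) s1 (M + 1)
       (\<lambda>s''. s'' i 0 = k \<and> ?J (Suc k) (store i 0 (Suc k) s''))"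
    proof (rule achieves_Seq)
      show "achieves Z c s1 M (\<lambda>s''. val e s'' = f k \<and> eq_off (written c) s1 s'')"
        using body[of k s1] k i J by (intro achieves_eq_off) auto
    next
      fix s2
      assume s2: "val e s2 = f k \<and> eq_off (written c) s1 s2"
      then have "s2 y = s1 y" "s2 i = s1 i" using assms(2,3) by (auto simp: eq_off_def)
      moreover have "eq_off ?W s s2" using J s2 by (auto simp: eq_off_def)
      ultimately show "achieves Z (Assign y (Var i) e) s2 1
          (\<lambda>s''. s'' i 0 = k \<and> ?J (Suc k) (store i 0 (Suc k) s''))"
        using s2 J i f[OF k] \<open>i \<noteq> y\<close>
        by (intro achieves_Assign) (auto simp: store_def eq_off_def less_Suc_eq)
    qed
  qed (use bound \<open>n \<le> Z\<close> \<open>i \<noteq> y\<close> in \<open>auto simp: store_def eq_off_def\<close>)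
  then show ?thesis unfolding Fill_def by (rule achieves_weaken) (auto simp: numeral_3_eq_3)
qed

lemma achieves_Accum_Skip:
  assumes "i \<noteq> y"
    and "\<And>k s'. k < n \<Longrightarrow> eq_off {y, i} s s' \<Longrightarrow> s' i 0 = k \<Longrightarrow> val e s' = f k"
    and "\<And>s'. eq_off {y, i} s s' \<Longrightarrow> val N s' = n"
    and "n \<le> Z" "(\<Sum>k<n. f k) \<le> Z"
  shows "achieves Z (Accum y i N Skip e) s (4 * n + 3)
    (\<lambda>s'. s' y 0 = (\<Sum>k<n. f k) \<and> eq_off {y, i} s s')"
proof -
  have "achieves Z Skip s' (Suc 0) (\<lambda>s''. val e s'' = f k)"
    if "k < n" "eq_off {y, i} s s'" "s' i 0 = k" for k s'
    using achieves_Skip[of "\<lambda>s''. val e s'' = f k"] assms(2)[OF that] by simp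
  then show ?thesis
    using achieves_Accum[of i y Skip n s Z 1 e f N] assms by (simp add: mult.commute)
qed

lemma achieves_Fill_Skip:
  assumes "i \<noteq> y"
    and "\<And>k s'. k < n \<Longrightarrow> eq_off {y, i} s s' \<Longrightarrow> s' i 0 = k \<Longrightarrow> val e s' = f k"
    and "\<And>s'. eq_off {y, i} s s' \<Longrightarrow> val N s' = n"
    and "n \<le> Z" "\<And>k. k < n \<Longrightarrow> f k \<le> Z"
  shows "achieves Z (Fill y i N Skip e) s (4 * n + 2)
    (\<lambda>s'. (\<forall>k<n. s' y k = f k) \<and> eq_off {y, i} s s')"
proof -
  have "achieves Z Skip s' (Suc 0) (\<lambda>s''. val e s'' = f k)"
    if "k < n" "eq_off {y, i} s s'" "s' i 0 = k" for k s'
    using achieves_Skip[of "\<lambda>s''. val e s'' = f k"] assms(2)[OF that] by simp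
  then show ?thesis
    using achieves_Fill[of i y Skip n s Z 1 e f N] assms by (simp add: mult.commute)
qed

section \<open>Enumerating the candidates\<close>

text \<open>By truncated subtraction, 1 - (a - b) is 1 if a \<le> b and 0 otherwise.\<close>

definition Le :: "expr \<Rightarrow> expr \<Rightarrow> expr" where
  "Le a b = Op Minus (Const 1) (Op Minus a b)"

lemma val_Le [simp]: "val (Le a b) s = of_bool (val a s \<le> val b s)"
  by (auto simp: Le_def)

text \<open>A single loop counter \<open>k = ((m n + u) (n + 1) + x) (n + 1) + y\<close> with \<open>m < 2\<close> enumerates the
  candidates: mode 0 is the greedy prefix of the pivot \<open>u\<close> together with the small items in
  \<open>{x..<y}\<close>, mode 1 is \<open>u\<close> together with all items in \<open>{x..<y}\<close>, which covers all pairs and the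
  set of all items.\<close>
definition decode_mode :: "nat \<Rightarrow> nat \<Rightarrow> nat" where
  "decode_mode n k = k div (n * ((n + 1) * (n + 1)))"

definition decode_pivot :: "nat \<Rightarrow> nat \<Rightarrow> nat" where
  "decode_pivot n k = (k div ((n + 1) * (n + 1))) mod n"

definition decode_left :: "nat \<Rightarrow> nat \<Rightarrow> nat" where
  "decode_left n k = (k div (n + 1)) mod (n + 1)"

definition decode_right :: "nat \<Rightarrow> nat \<Rightarrow> nat" where
  "decode_right n k = k mod (n + 1)"

lemma decode_exists:
  assumes "m < 2" "u < n" "x \<le> n" "y \<le> n"
  obtains k where "k < 2 * n * ((n + 1) * (n + 1))"
    "decode_mode n k = m" "decode_pivot n k = u" "decode_left n k = x" "decode_right n k = y"
proof -
  define N where "N = n + 1"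
  define k2 where "k2 = m * n + u"
  define k1 where "k1 = k2 * N + x"
  define k where "k = k1 * N + y"
  have digit: "(c * b + r) div b = c" "(c * b + r) mod b = r" if "r < b" for b c r :: nat
    using that by simp_all
  have lt: "x < N" "y < N" using assms by (auto simp: N_def)
  have q1: "k div N = k1" "k mod N = y" unfolding k_def using digit lt by auto
  have q2: "k1 div N = k2" "k1 mod N = x" unfolding k1_def using digit lt by auto
  have q3: "k2 div n = m" "k2 mod n = u" unfolding k2_def using digit assms by auto
  have div_NN: "k div (N * N) = k2" by (simp add: div_mult2_eq q1 q2)
  have mode: "k div (n * (N * N)) = m"
    by (simp add: mult.commute[of n] div_mult2_eq[of k "N * N"] div_NN q3)
  show ?thesis
  proof (rule that)
    have "0 < n * (N * N)" using assms by (simp add: N_def)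
    then have "k < 2 * (n * (N * N))"
      using assms(1)[folded mode] div_less_iff_less_mult[of "n * (N * N)" k 2] by blast
    then show "k < 2 * n * ((n + 1) * (n + 1))" by (simp only: N_def mult.assoc)
  qed (simp_all only: decode_mode_def decode_pivot_def decode_left_def decode_right_def
      N_def[symmetric] mode div_NN q1 q2 q3)
qed

definition N_expr :: expr where "N_expr = Op Plus (Var ''n'') (Const 1)"

definition NN_expr :: expr where "NN_expr = Op Times N_expr N_expr"

definition mode_expr :: expr where
  "mode_expr = Op Div (Var ''k'') (Op Times (Var ''n'') NN_expr)"

definition pivot_expr :: expr where
  "pivot_expr = Op Mod (Op Div (Var ''k'') NN_expr) (Var ''n'')"

definition left_expr :: expr where
  "left_expr = Op Mod (Op Div (Var ''k'') N_expr) N_expr"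

definition right_expr :: expr where "right_expr = Op Mod (Var ''k'') N_expr"

definition light_expr :: "expr \<Rightarrow> expr" where
  "light_expr v = Le (Op Times (Const 4) (Read ''w'' v)) (Var ''D'')"

text \<open>A product and an index are packed into one number with the index as last digit in base
  \<open>n + 1\<close>, so that a single comparison decides the lexicographic order.\<close>

definition key_expr :: "expr \<Rightarrow> expr \<Rightarrow> expr" where
  "key_expr v u = Op Plus (Op Times (Op Times (Read ''w'' v) (Read ''d'' u)) N_expr) v"

definition in_interval_expr :: expr where
  "in_interval_expr = Op Times (Le left_expr (Var ''j'')) (Le (Op Plus (Var ''j'') (Const 1)) right_expr)"

text \<open>On 0-1 values products are conjunctions and sums are disjunctions; the outer comparison
  with 1 turns the number of true disjuncts back into an indicator.\<close>

definition candidate_expr :: expr where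
  "candidate_expr = Le (Const 1) (Op Plus
     (Op Times (Le mode_expr (Const 0)) (Op Times (light_expr (Var ''j''))
       (Op Plus (Le (key_expr (Var ''j'') pivot_expr) (key_expr pivot_expr (Var ''j''))) in_interval_expr)))
     (Op Times (Le (Const 1) mode_expr)
       (Op Plus (Op Times (Le (Var ''j'') pivot_expr) (Le pivot_expr (Var ''j''))) in_interval_expr)))"

section \<open>The program\<close>

definition compute_scale :: com where
  "compute_scale = Seq (Assign ''D'' (Const 0) (Const 1))
     (For ''i'' (Var ''p'') (Assign ''D'' (Const 0) (Op Times (Var ''D'') (Read ''Wnum'' (Var ''i'')))))"

definition row_index :: "string \<Rightarrow> string \<Rightarrow> expr" where
  "row_index i j = Op Plus (Op Times (Var i) (Var ''n'')) (Var j)"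

definition compute_weights :: com where
  "compute_weights = Fill ''w'' ''j'' (Var ''n'')
     (Accum ''t'' ''i'' (Var ''p'') Skip
        (Op Times (Op Times (Read ''A'' (row_index ''i'' ''j'')) (Read ''Wden'' (Var ''i'')))
           (Op Div (Var ''D'') (Read ''Wnum'' (Var ''i'')))))
     (Var ''t'')"

definition compute_degrees :: com where
  "compute_degrees = Fill ''d'' ''j'' (Var ''n'')
     (Accum ''t'' ''i'' (Var ''n'') Skip
        (Op Times (Read ''B'' (row_index ''j'' ''i'')) (light_expr (Var ''i''))))
     (Op Plus (Var ''t'') (Read ''c'' (Var ''j'')))"

definition build_candidate :: com where
  "build_candidate = Fill ''Y'' ''j'' (Var ''n'') Skip candidate_expr"

text \<open>Clearing the denominator makes the test integral: the truncated difference is nonzero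
  exactly when the constraint fails.\<close>

definition count_violations :: com where
  "count_violations = Accum ''f'' ''i'' (Var ''p'')
     (Accum ''t'' ''j'' (Var ''n'') Skip
        (Op Times (Read ''A'' (row_index ''i'' ''j'')) (Read ''Y'' (Var ''j''))))
     (Le (Const 1) (Op Minus (Op Times (Read ''Wden'' (Var ''i'')) (Var ''t'')) (Read ''Wnum'' (Var ''i''))))"

definition compute_objective :: com where
  "compute_objective = Accum ''o'' ''i'' (Var ''n'')
     (Accum ''t'' ''j'' (Var ''n'') Skip
        (Op Times (Read ''B'' (row_index ''i'' ''j'')) (Read ''Y'' (Var ''j''))))
     (Op Times (Read ''Y'' (Var ''i'')) (Op Plus (Read ''c'' (Var ''i'')) (Var ''t'')))"

definition keep_better :: com where
  "keep_better = If (Op Times (Le (Var ''f'') (Const 0)) (Op Minus (Var ''o'') (Var ''best'')))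
     (Seq (Assign ''best'' (Const 0) (Var ''o''))
        (Fill ''X'' ''j'' (Var ''n'') Skip (Read ''Y'' (Var ''j''))))
     Skip"

definition enumerate_candidates :: com where
  "enumerate_candidates = For ''k'' (Op Times (Op Times (Const 2) (Var ''n'')) NN_expr)
     (Seq build_candidate (Seq count_violations (Seq compute_objective keep_better)))"

definition program :: com where
  "program = Seq compute_scale (Seq compute_weights (Seq compute_degrees enumerate_candidates))"

lemma written_simps [simp]:
  "written compute_scale = {''D'', ''i''}"
  "written compute_weights = {''w'', ''j'', ''t'', ''i''}"
  "written compute_degrees = {''d'', ''j'', ''t'', ''i''}"
  "written build_candidate = {''Y'', ''j''}"
  "written count_violations = {''f'', ''i'', ''t'', ''j''}"
  "written compute_objective = {''o'', ''i'', ''t'', ''j''}"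
  "written keep_better = {''best'', ''X'', ''j''}"
  by (auto simp: compute_scale_def compute_weights_def compute_degrees_def build_candidate_def
      count_violations_def compute_objective_def keep_better_def)

text \<open>Decouples the program from \<open>piqp\<close> records: the proof works with functions
  of items and constraints, and the row-by-row storage is confined to \<open>init_A\<close> and
  \<open>init_B\<close>.\<close>

locale machine_input =
  fixes init :: mem and n p :: nat
    and cost_lin num den :: "nat \<Rightarrow> nat" and entry cost_quad :: "nat \<Rightarrow> nat \<Rightarrow> nat"
  assumes init_n: "init ''n'' 0 = n" and init_p: "init ''p'' 0 = p"
    and init_c: "v < n \<Longrightarrow> init ''c'' v = cost_lin v"
    and init_num: "i < p \<Longrightarrow> init ''Wnum'' i = num i"
    and init_den: "i < p \<Longrightarrow> init ''Wden'' i = den i"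
    and init_A: "i < p \<Longrightarrow> v < n \<Longrightarrow> init ''A'' (i * n + v) = entry i v"
    and init_B: "u < n \<Longrightarrow> v < n \<Longrightarrow> init ''B'' (u * n + v) = cost_quad u v"
    and init_best: "init ''best'' 0 = 0" and init_X: "v < n \<Longrightarrow> init ''X'' v = 0"
begin

text \<open>\<open>weight v / scale\<close> is the sum over all constraints \<open>i\<close> of \<open>a\<^sub>i\<^sub>v / W\<^sub>i\<close>; all divisions are exact.\<close>
definition scale :: nat where "scale = (\<Prod>i<p. num i)"

definition weight :: "nat \<Rightarrow> nat" where
  "weight v = (\<Sum>i<p. entry i v * den i * (scale div num i))"

definition light :: "nat \<Rightarrow> bool" where "light v \<longleftrightarrow> 4 * weight v \<le> scale"

definition deg :: "nat \<Rightarrow> nat" where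
  "deg u = (\<Sum>v<n. cost_quad u v * of_bool (light v)) + cost_lin u"

text \<open>Comparison of the ratios \<open>weight / deg\<close> with ties broken by the index, which is at most \<open>n\<close>.\<close>
definition precedes :: "nat \<Rightarrow> nat \<Rightarrow> bool" where
  "precedes v u \<longleftrightarrow> weight v * deg u * (n + 1) + v \<le> weight u * deg v * (n + 1) + u"

definition candidate :: "nat \<Rightarrow> nat set" where
  "candidate k = {v. v < n \<and>
     (let interval = decode_left n k \<le> v \<and> v < decode_right n k; u = decode_pivot n k in
       if decode_mode n k = 0 then light v \<and> (precedes v u \<or> interval) else v = u \<or> interval)}"

definition fits :: "nat set \<Rightarrow> bool" where
  "fits S \<longleftrightarrow> (\<forall>i<p. den i * (\<Sum>v\<in>S. entry i v) \<le> num i)"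

definition gain :: "nat set \<Rightarrow> nat" where
  "gain S = (\<Sum>u\<in>S. cost_lin u + (\<Sum>v\<in>S. cost_quad u v))"

definition reads_input :: "mem \<Rightarrow> bool" where
  "reads_input s \<longleftrightarrow>
     (\<forall>x \<in> {''n'', ''p'', ''c'', ''Wnum'', ''Wden'', ''A'', ''B''}. s x = init x)"

lemma reads_input_simps:
  assumes "reads_input s"
  shows "s ''n'' 0 = n" "s ''p'' 0 = p"
    "v < n \<Longrightarrow> s ''c'' v = cost_lin v" "i < p \<Longrightarrow> s ''Wnum'' i = num i" "i < p \<Longrightarrow> s ''Wden'' i = den i"
    "i < p \<Longrightarrow> v < n \<Longrightarrow> s ''A'' (i * n + v) = entry i v"
    "u < n \<Longrightarrow> v < n \<Longrightarrow> s ''B'' (u * n + v) = cost_quad u v"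
  using assms by (auto simp: reads_input_def init_n init_p init_c init_num init_den init_A init_B)

lemma reads_input_eq_off:
  "reads_input s \<Longrightarrow> eq_off W s s' \<Longrightarrow>
    W \<inter> {''n'', ''p'', ''c'', ''Wnum'', ''Wden'', ''A'', ''B''} = {} \<Longrightarrow> reads_input s'"
  by (auto simp: reads_input_def eq_off_def)

lemma sum_restrict: "S \<subseteq> {..<n} \<Longrightarrow> (\<Sum>v<n. f v * of_bool (v \<in> S)) = (\<Sum>v\<in>S. f v)"
  for f :: "nat \<Rightarrow> nat"
  by (auto intro!: sum.mono_neutral_cong_right)

end

text \<open>\<open>Z\<close> dominates everything the program stores, including sums for candidates
  that violate constraints; values inside expressions, such as the comparison keys, may exceed it.
  The strict \<open>n < Z\<close> provides \<open>1 \<le> Z\<close> even for \<open>n = 0\<close>,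
  as needed for stored constants and indicators.\<close>

locale bounded_machine_input = machine_input +
  fixes Z :: nat
  assumes n_less: "n < Z" and p_le: "p \<le> Z" and loops_le: "2 * n * ((n + 1) * (n + 1)) \<le> Z"
    and num_pos: "i < p \<Longrightarrow> 0 < num i"
    and scale_le: "scale \<le> Z"
    and weight_le: "v < n \<Longrightarrow> weight v \<le> Z"
    and deg_le: "u < n \<Longrightarrow> deg u \<le> Z"
    and row_A_le: "i < p \<Longrightarrow> (\<Sum>v<n. entry i v) \<le> Z"
    and row_B_le: "u < n \<Longrightarrow> (\<Sum>v<n. cost_quad u v) \<le> Z"
    and gain_le: "S \<subseteq> {..<n} \<Longrightarrow> gain S \<le> Z"
begin

section \<open>Correctness of the phases of the program\<close>

lemma achieves_compute_scale:
  assumes s: "reads_input s"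
  shows "achieves Z compute_scale s (3 * p + 3) (\<lambda>s'. s' ''D'' 0 = scale)"
proof -
  let ?J = "\<lambda>k s'. s' ''D'' 0 = (\<Prod>i<k. num i) \<and> reads_input s'"
  \<comment> \<open>A partial product divides the full one, which is positive, so it cannot exceed
    it.\<close>
  have partial: "(\<Prod>i<k. num i) \<le> Z" if "k \<le> p" for k
  proof -
    have "(\<Prod>i<k. num i) dvd scale"
      unfolding scale_def using that by (intro prod_dvd_prod_subset) simp_all
    moreover have "0 < scale" unfolding scale_def by (intro prod_pos) (auto simp: num_pos)
    ultimately have "(\<Prod>i<k. num i) \<le> scale" by (rule dvd_imp_le)
    then show ?thesis using scale_le by (rule order_trans)
  qed
  have scale_1: "1 \<le> Z" using n_less by simp
  have "achieves Z compute_scale s (1 + (p * (1 + 2) + 2)) (\<lambda>s'. s' ''i'' 0 = p \<and> ?J p s')"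
    unfolding compute_scale_def
  proof (rule achieves_Seq)
    show "achieves Z (Assign ''D'' (Const 0) (Const 1)) s 1 (?J 0)"
      using s scale_1 by (intro achieves_Assign) (auto simp: store_def reads_input_def)
  next
    fix s'
    assume s': "?J 0 s'"
    show "achieves Z (For ''i'' (Var ''p'')
        (Assign ''D'' (Const 0) (Op Times (Var ''D'') (Read ''Wnum'' (Var ''i''))))) s' (p * (1 + 2) + 2)
        (\<lambda>s'. s' ''i'' 0 = p \<and> ?J p s')"
    proof (rule achieves_For)
      fix k s1
      assume k: "k < p" "?J k s1" "s1 ''i'' 0 = k"
      show "achieves Z (Assign ''D'' (Const 0) (Op Times (Var ''D'') (Read ''Wnum'' (Var ''i'')))) s1 1
          (\<lambda>s''. s'' ''i'' 0 = k \<and> ?J (Suc k) (store ''i'' 0 (Suc k) s''))"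
        using k partial[of "Suc k"] reads_input_simps[of s1]
        by (intro achieves_Assign) (auto simp: store_def reads_input_def)
    qed (use s' reads_input_simps(2) p_le in \<open>auto simp: store_def reads_input_def\<close>)
  qed
  then show ?thesis by (rule achieves_weaken) (auto simp: scale_def)
qed

lemma achieves_compute_weights:
  assumes s: "reads_input s" and D: "s ''D'' 0 = scale"
  shows "achieves Z compute_weights s (n * (4 * p + 6) + 2) (\<lambda>s'. \<forall>v<n. s' ''w'' v = weight v)"
proof -
  have "achieves Z compute_weights s (n * ((4 * p + 3) + 3) + 2)
      (\<lambda>s'. (\<forall>v<n. s' ''w'' v = weight v) \<and> eq_off {''w'', ''j'', ''t'', ''i''} s s')"
    unfolding compute_weights_def
  proof (rule achieves_weaken[OF achieves_Fill[where f = weight]])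
    fix k s1
    assume "eq_off (insert ''w'' (insert ''j'' (written (Accum ''t'' ''i'' (Var ''p'') Skip
        (Op Times (Op Times (Read ''A'' (row_index ''i'' ''j'')) (Read ''Wden'' (Var ''i'')))
           (Op Div (Var ''D'') (Read ''Wnum'' (Var ''i'')))))))) s s1"
    then have off1: "eq_off {''w'', ''j'', ''t'', ''i''} s s1" by simp
    with s have r1: "reads_input s1" by (rule reads_input_eq_off) auto
    show "val (Var ''n'') s1 = n" using r1 by (simp add: reads_input_simps)
    assume k: "k < n" "s1 ''j'' 0 = k"
    show "achieves Z (Accum ''t'' ''i'' (Var ''p'') Skip
        (Op Times (Op Times (Read ''A'' (row_index ''i'' ''j'')) (Read ''Wden'' (Var ''i'')))
           (Op Div (Var ''D'') (Read ''Wnum'' (Var ''i''))))) s1 (4 * p + 3)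
         (\<lambda>s''. val (Var ''t'') s'' = weight k)"
    proof (rule achieves_weaken[OF achieves_Accum_Skip[where
            f = "\<lambda>i. entry i k * den i * (scale div num i)" and n = p]])
      fix i s2
      assume off2: "eq_off {''t'', ''i''} s1 s2"
      with r1 have r2: "reads_input s2" by (rule reads_input_eq_off) auto
      show "val (Var ''p'') s2 = p" using r2 by (simp add: reads_input_simps)
      assume i: "i < p" "s2 ''i'' 0 = i"
      have "s2 ''D'' = s ''D''" "s2 ''j'' = s1 ''j''"
        using off1 off2 by (auto simp: eq_off_def)
      then show "val (Op Times (Op Times (Read ''A'' (row_index ''i'' ''j''))
          (Read ''Wden'' (Var ''i''))) (Op Div (Var ''D'') (Read ''Wnum'' (Var ''i'')))) s2
          = entry i k * den i * (scale div num i)"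
        using i k D r2 by (simp add: row_index_def reads_input_simps)
    qed (use k weight_le p_le in \<open>auto simp: weight_def\<close>)
  qed (use weight_le n_less in auto)
  then show ?thesis by (rule achieves_weaken) (auto simp: algebra_simps)
qed

end

context bounded_machine_input begin

definition prepared :: "mem \<Rightarrow> bool" where
  "prepared s \<longleftrightarrow> reads_input s \<and> s ''D'' 0 = scale \<and>
     (\<forall>v<n. s ''w'' v = weight v) \<and> (\<forall>v<n. s ''d'' v = deg v)"

lemma prepared_eq_off:
  "prepared s \<Longrightarrow> eq_off W s s' \<Longrightarrow>
    W \<inter> {''n'', ''p'', ''c'', ''Wnum'', ''Wden'', ''A'', ''B'', ''D'', ''w'', ''d''} = {} \<Longrightarrow> prepared s'"
  by (auto simp: prepared_def reads_input_def eq_off_def)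

lemma achieves_compute_degrees:
  assumes s: "reads_input s" and D: "s ''D'' 0 = scale" and w: "\<forall>v<n. s ''w'' v = weight v"
  shows "achieves Z compute_degrees s (n * (4 * n + 6) + 2) (\<lambda>s'. \<forall>v<n. s' ''d'' v = deg v)"
proof -
  have "achieves Z compute_degrees s (n * ((4 * n + 3) + 3) + 2)
      (\<lambda>s'. (\<forall>v<n. s' ''d'' v = deg v) \<and> eq_off {''d'', ''j'', ''t'', ''i''} s s')"
    unfolding compute_degrees_def
  proof (rule achieves_weaken[OF achieves_Fill[where f = deg]])
    fix k s1
    assume "eq_off (insert ''d'' (insert ''j'' (written (Accum ''t'' ''i'' (Var ''n'') Skip
        (Op Times (Read ''B'' (row_index ''j'' ''i'')) (light_expr (Var ''i''))))))) s s1"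
    then have off1: "eq_off {''d'', ''j'', ''t'', ''i''} s s1" by simp
    with s have r1: "reads_input s1" by (rule reads_input_eq_off) auto
    show "val (Var ''n'') s1 = n" using r1 by (simp add: reads_input_simps)
    assume k: "k < n" "s1 ''j'' 0 = k"
    have "(\<Sum>v<n. cost_quad k v * of_bool (light v)) \<le> deg k" by (simp add: deg_def)
    then have le: "(\<Sum>v<n. cost_quad k v * of_bool (light v)) \<le> Z" using deg_le[OF k(1)] by simp
    show "achieves Z (Accum ''t'' ''i'' (Var ''n'') Skip
        (Op Times (Read ''B'' (row_index ''j'' ''i'')) (light_expr (Var ''i'')))) s1 (4 * n + 3)
         (\<lambda>s''. val (Op Plus (Var ''t'') (Read ''c'' (Var ''j''))) s'' = deg k)"
    proof (rule achieves_weaken[OF achieves_Accum_Skip[where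
            f = "\<lambda>v. cost_quad k v * of_bool (light v)" and n = n]])
      fix i s2
      assume off2: "eq_off {''t'', ''i''} s1 s2"
      with r1 have r2: "reads_input s2" by (rule reads_input_eq_off) auto
      show "val (Var ''n'') s2 = n" using r2 by (simp add: reads_input_simps)
      assume i: "i < n" "s2 ''i'' 0 = i"
      have "s2 ''D'' = s ''D''" "s2 ''w'' = s ''w''" "s2 ''j'' = s1 ''j''"
        using off1 off2 by (auto simp: eq_off_def)
      then show "val (Op Times (Read ''B'' (row_index ''j'' ''i'')) (light_expr (Var ''i''))) s2
          = cost_quad k i * of_bool (light i)"
        using i k D w r2 by (simp add: row_index_def light_expr_def light_def reads_input_simps)
    next
      fix s2
      assume s2: "s2 ''t'' 0 = (\<Sum>v<n. cost_quad k v * of_bool (light v)) \<and> eq_off {''t'', ''i''} s1 s2"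
      then have "reads_input s2" using r1 by (auto elim: reads_input_eq_off)
      moreover have "s2 ''j'' = s1 ''j''" using s2 by (auto simp: eq_off_def)
      ultimately show "val (Op Plus (Var ''t'') (Read ''c'' (Var ''j''))) s2 = deg k"
        using s2 k by (simp add: deg_def reads_input_simps)
    qed (use n_less le in auto)
  qed (use deg_le n_less in auto)
  then show ?thesis by (rule achieves_weaken) (auto simp: algebra_simps)
qed

lemma val_candidate_expr:
  assumes s: "prepared s" and j: "s ''j'' 0 < n"
  shows "val candidate_expr s = of_bool (s ''j'' 0 \<in> candidate (s ''k'' 0))"
proof -
  define k j where "k = s ''k'' 0" and "j = s ''j'' 0"
  have r: "reads_input s" and D: "s ''D'' 0 = scale"
    and wd: "\<And>v. v < n \<Longrightarrow> s ''w'' v = weight v" "\<And>v. v < n \<Longrightarrow> s ''d'' v = deg v"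
    using s by (auto simp: prepared_def)
  \<comment> \<open>\<open>j < n\<close> forces \<open>0 < n\<close>, so a remainder modulo
    \<open>n\<close> is a valid index.\<close>
  have u: "decode_pivot n k < n" and j': "j < n" using j by (auto simp: decode_pivot_def j_def)
  have N: "val N_expr s = n + 1" using r by (simp add: N_expr_def reads_input_simps)
  have NN: "val NN_expr s = (n + 1) * (n + 1)" unfolding NN_expr_def val.simps opval.simps N ..
  have decoded: "val mode_expr s = decode_mode n k" "val pivot_expr s = decode_pivot n k"
    "val left_expr s = decode_left n k" "val right_expr s = decode_right n k"
    using r by (simp_all add: mode_expr_def pivot_expr_def left_expr_def right_expr_def N NN
        decode_mode_def decode_pivot_def decode_left_def decode_right_def k_def reads_input_simps
        del: mult_Suc mult_Suc_right)
  have jv: "val (Var ''j'') s = j" by (simp add: j_def)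
  have light: "val (light_expr (Var ''j'')) s = of_bool (light j)"
    using D wd j' by (simp add: light_expr_def light_def j_def)
  have key: "val (key_expr e f) s = weight (val e s) * deg (val f s) * (n + 1) + val e s"
    if "val e s < n" "val f s < n" for e f
    unfolding key_expr_def val.simps opval.simps N wd(1)[OF that(1)] wd(2)[OF that(2)] ..
  have interval: "val in_interval_expr s = of_bool (decode_left n k \<le> j \<and> j < decode_right n k)"
    unfolding in_interval_expr_def val.simps(3) opval.simps val_Le decoded jv by (auto simp: Suc_le_eq)
  have order: "val (Le (key_expr (Var ''j'') pivot_expr) (key_expr pivot_expr (Var ''j''))) s =
      of_bool (precedes j (decode_pivot n k))"
    unfolding val_Le precedes_def
    using key[of "Var ''j''" pivot_expr] key[of pivot_expr "Var ''j''"] u j' by (simp only: decoded jv)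
  show ?thesis
    unfolding candidate_expr_def val_Le val.simps(1,3) opval.simps light interval
      order[unfolded val_Le] decoded jv
    using j' by (auto simp: candidate_def Let_def k_def[symmetric] j_def[symmetric] of_bool_def
        simp del: val.simps)
qed

lemma achieves_build_candidate:
  assumes s: "prepared s"
  shows "achieves Z build_candidate s (4 * n + 2)
    (\<lambda>s'. \<forall>v<n. s' ''Y'' v = of_bool (v \<in> candidate (s ''k'' 0)))"
  unfolding build_candidate_def
proof (rule achieves_weaken[OF achieves_Fill_Skip[where
        f = "\<lambda>v. of_bool (v \<in> candidate (s ''k'' 0))" and n = n]])
  fix k s1
  assume off: "eq_off {''Y'', ''j''} s s1"
  with s have p1: "prepared s1" by (rule prepared_eq_off) auto
  then show "val (Var ''n'') s1 = n" by (simp add: prepared_def reads_input_simps)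
  assume "k < n" "s1 ''j'' 0 = k"
  moreover have "s1 ''k'' = s ''k''" using off by (auto simp: eq_off_def)
  ultimately show "val candidate_expr s1 = of_bool (k \<in> candidate (s ''k'' 0))"
    using val_candidate_expr[OF p1] by simp
next
  fix k
  assume "k < n"
  then show "of_bool (k \<in> candidate (s ''k'' 0)) \<le> Z" using n_less by simp
qed (use n_less in auto)

lemma achieves_count_violations:
  assumes s: "reads_input s" and Y: "\<forall>v<n. s ''Y'' v = of_bool (v \<in> S)" and S: "S \<subseteq> {..<n}"
  shows "achieves Z count_violations s (p * (4 * n + 6) + 3) (\<lambda>s'. s' ''f'' 0 = 0 \<longleftrightarrow> fits S)"
proof -
  let ?bad = "\<lambda>i. of_bool (num i < den i * (\<Sum>v\<in>S. entry i v)) :: nat"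
  have "achieves Z count_violations s (p * ((4 * n + 3) + 3) + 3)
      (\<lambda>s'. s' ''f'' 0 = (\<Sum>i<p. ?bad i) \<and> eq_off {''f'', ''i'', ''t'', ''j''} s s')"
    unfolding count_violations_def
  proof (rule achieves_weaken[OF achieves_Accum[where f = ?bad]])
    fix i s1
    assume "eq_off (insert ''f'' (insert ''i'' (written (Accum ''t'' ''j'' (Var ''n'') Skip
        (Op Times (Read ''A'' (row_index ''i'' ''j'')) (Read ''Y'' (Var ''j''))))))) s s1"
    then have off1: "eq_off {''f'', ''i'', ''t'', ''j''} s s1" by simp
    with s have r1: "reads_input s1" by (rule reads_input_eq_off) auto
    show "val (Var ''p'') s1 = p" using r1 by (simp add: reads_input_simps)
    assume i: "i < p" "s1 ''i'' 0 = i"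
    have "(\<Sum>v<n. entry i v * of_bool (v \<in> S)) \<le> (\<Sum>v<n. entry i v)" by (intro sum_mono) simp
    then have le: "(\<Sum>v<n. entry i v * of_bool (v \<in> S)) \<le> Z" using row_A_le[OF i(1)] by simp
    show "achieves Z (Accum ''t'' ''j'' (Var ''n'') Skip
        (Op Times (Read ''A'' (row_index ''i'' ''j'')) (Read ''Y'' (Var ''j'')))) s1 (4 * n + 3)
      (\<lambda>s''. val (Le (Const 1) (Op Minus (Op Times (Read ''Wden'' (Var ''i'')) (Var ''t''))
          (Read ''Wnum'' (Var ''i'')))) s'' = ?bad i)"
    proof (rule achieves_weaken[OF achieves_Accum_Skip[where
            f = "\<lambda>v. entry i v * of_bool (v \<in> S)" and n = n]])
      fix v s2
      assume off2: "eq_off {''t'', ''j''} s1 s2"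
      with r1 have r2: "reads_input s2" by (rule reads_input_eq_off) auto
      show "val (Var ''n'') s2 = n" using r2 by (simp add: reads_input_simps)
      assume v: "v < n" "s2 ''j'' 0 = v"
      have "s2 ''Y'' = s ''Y''" "s2 ''i'' = s1 ''i''" using off1 off2 by (auto simp: eq_off_def)
      then show "val (Op Times (Read ''A'' (row_index ''i'' ''j'')) (Read ''Y'' (Var ''j''))) s2 =
          entry i v * of_bool (v \<in> S)"
        using i v r2 Y by (simp add: row_index_def reads_input_simps)
    next
      fix s2
      assume s2: "s2 ''t'' 0 = (\<Sum>v<n. entry i v * of_bool (v \<in> S)) \<and> eq_off {''t'', ''j''} s1 s2"
      then have "reads_input s2" using r1 by (auto elim: reads_input_eq_off)
      moreover have "s2 ''i'' = s1 ''i''" using s2 by (auto simp: eq_off_def)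
      ultimately show "val (Le (Const 1) (Op Minus (Op Times (Read ''Wden'' (Var ''i'')) (Var ''t''))
          (Read ''Wnum'' (Var ''i'')))) s2 = ?bad i"
        using s2 i by (simp add: sum_restrict[OF S] reads_input_simps Suc_le_eq del: sum_mult_of_bool_eq)
    qed (use n_less le in auto)
  next
    have "(\<Sum>i<p. ?bad i) \<le> (\<Sum>i<p. 1)" by (intro sum_mono) simp
    then show "(\<Sum>i<p. ?bad i) \<le> Z" using p_le by simp
  qed (use p_le in auto)
  then show ?thesis
    by (rule achieves_weaken) (auto simp: fits_def algebra_simps not_less)
qed

lemma achieves_compute_objective:
  assumes s: "reads_input s" and Y: "\<forall>v<n. s ''Y'' v = of_bool (v \<in> S)" and S: "S \<subseteq> {..<n}"
  shows "achieves Z compute_objective s (n * (4 * n + 6) + 3) (\<lambda>s'. s' ''o'' 0 = gain S)"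
proof -
  define f where "f u = of_bool (u \<in> S) * (cost_lin u + (\<Sum>v\<in>S. cost_quad u v))" for u
  have sum_f: "(\<Sum>u<n. f u) = gain S"
    unfolding gain_def f_def by (simp only: mult.commute[of "of_bool _"] sum_restrict[OF S])
  have "achieves Z compute_objective s (n * ((4 * n + 3) + 3) + 3)
      (\<lambda>s'. s' ''o'' 0 = gain S \<and> eq_off {''o'', ''i'', ''t'', ''j''} s s')"
    unfolding compute_objective_def
  proof (rule achieves_weaken[OF achieves_Accum[where f = f and n = n]])
    fix i s1
    assume "eq_off (insert ''o'' (insert ''i'' (written (Accum ''t'' ''j'' (Var ''n'') Skip
        (Op Times (Read ''B'' (row_index ''i'' ''j'')) (Read ''Y'' (Var ''j''))))))) s s1"
    then have off1: "eq_off {''o'', ''i'', ''t'', ''j''} s s1" by simp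
    with s have r1: "reads_input s1" by (rule reads_input_eq_off) auto
    show "val (Var ''n'') s1 = n" using r1 by (simp add: reads_input_simps)
    assume i: "i < n" "s1 ''i'' 0 = i"
    have Y1: "s1 ''Y'' = s ''Y''" using off1 by (auto simp: eq_off_def)
    have "(\<Sum>v<n. cost_quad i v * of_bool (v \<in> S)) \<le> (\<Sum>v<n. cost_quad i v)" by (intro sum_mono) simp
    then have le: "(\<Sum>v<n. cost_quad i v * of_bool (v \<in> S)) \<le> Z" using row_B_le[OF i(1)] by simp
    show "achieves Z (Accum ''t'' ''j'' (Var ''n'') Skip
        (Op Times (Read ''B'' (row_index ''i'' ''j'')) (Read ''Y'' (Var ''j'')))) s1 (4 * n + 3)
      (\<lambda>s''. val (Op Times (Read ''Y'' (Var ''i'')) (Op Plus (Read ''c'' (Var ''i'')) (Var ''t''))) s'' = f i)"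
    proof (rule achieves_weaken[OF achieves_Accum_Skip[where
            f = "\<lambda>v. cost_quad i v * of_bool (v \<in> S)" and n = n]])
      fix v s2
      assume off2: "eq_off {''t'', ''j''} s1 s2"
      with r1 have r2: "reads_input s2" by (rule reads_input_eq_off) auto
      show "val (Var ''n'') s2 = n" using r2 by (simp add: reads_input_simps)
      assume v: "v < n" "s2 ''j'' 0 = v"
      have "s2 ''Y'' = s ''Y''" "s2 ''i'' = s1 ''i''" using Y1 off2 by (auto simp: eq_off_def)
      then show "val (Op Times (Read ''B'' (row_index ''i'' ''j'')) (Read ''Y'' (Var ''j''))) s2 =
          cost_quad i v * of_bool (v \<in> S)"
        using i v r2 Y by (simp add: row_index_def reads_input_simps)
    next
      fix s2
      assume s2: "s2 ''t'' 0 = (\<Sum>v<n. cost_quad i v * of_bool (v \<in> S)) \<and> eq_off {''t'', ''j''} s1 s2"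
      then have "reads_input s2" using r1 by (auto elim: reads_input_eq_off)
      moreover have "s2 ''i'' = s1 ''i''" "s2 ''Y'' = s ''Y''" using s2 Y1 by (auto simp: eq_off_def)
      ultimately show "val (Op Times (Read ''Y'' (Var ''i'')) (Op Plus (Read ''c'' (Var ''i'')) (Var ''t''))) s2 = f i"
        using s2 i Y by (simp add: f_def sum_restrict[OF S] reads_input_simps del: sum_mult_of_bool_eq)
    qed (use n_less le in auto)
  qed (use n_less gain_le[OF S] in \<open>auto simp: sum_f\<close>)
  then show ?thesis by (rule achieves_weaken) (auto simp: algebra_simps)
qed

text \<open>The stored set has to be feasible but need not be a candidate, so the empty set can
  serve before the first round, and the output is feasible whatever the candidates are.\<close>

definition best_among :: "nat \<Rightarrow> mem \<Rightarrow> bool" where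
  "best_among K s \<longleftrightarrow> (\<exists>S \<subseteq> {..<n}. fits S \<and> (\<forall>v<n. s ''X'' v = of_bool (v \<in> S)) \<and> s ''best'' 0 = gain S \<and>
     (\<forall>k<K. fits (candidate k) \<longrightarrow> gain (candidate k) \<le> gain S))"

lemma best_among_eq_off:
  "best_among K s \<Longrightarrow> eq_off W s s' \<Longrightarrow> W \<inter> {''X'', ''best''} = {} \<Longrightarrow> best_among K s'"
  by (auto simp: best_among_def eq_off_def)

lemma candidate_subset: "candidate k \<subseteq> {..<n}"
  by (auto simp: candidate_def)

lemma achieves_keep_better:
  assumes r: "reads_input s" and best: "best_among k s"
    and Y: "\<forall>v<n. s ''Y'' v = of_bool (v \<in> candidate k)"
    and f: "s ''f'' 0 = 0 \<longleftrightarrow> fits (candidate k)" and o: "s ''o'' 0 = gain (candidate k)"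
  shows "achieves Z keep_better s (4 * n + 4) (\<lambda>s'. best_among (Suc k) s')"
proof -
  obtain S where S: "S \<subseteq> {..<n}" "fits S" "\<forall>v<n. s ''X'' v = of_bool (v \<in> S)" "s ''best'' 0 = gain S"
    "\<forall>j<k. fits (candidate j) \<longrightarrow> gain (candidate j) \<le> gain S"
    using best by (auto simp: best_among_def)
  have "achieves Z keep_better s ((1 + (4 * n + 2)) + 1) (\<lambda>s'. best_among (Suc k) s')"
    unfolding keep_better_def
  proof (rule achieves_If)
    assume "val (Op Times (Le (Var ''f'') (Const 0)) (Op Minus (Var ''o'') (Var ''best''))) s \<noteq> 0"
    then have better: "fits (candidate k)" "gain S < gain (candidate k)" using f o S(4) by auto
    show "achieves Z (Seq (Assign ''best'' (Const 0) (Var ''o''))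
        (Fill ''X'' ''j'' (Var ''n'') Skip (Read ''Y'' (Var ''j'')))) s (1 + (4 * n + 2))
        (\<lambda>s'. best_among (Suc k) s')"
    proof (rule achieves_Seq)
      show "achieves Z (Assign ''best'' (Const 0) (Var ''o'')) s 1
          (\<lambda>s'. s' ''best'' 0 = gain (candidate k) \<and> eq_off {''best''} s s')"
        using o gain_le[OF candidate_subset] by (intro achieves_Assign) (auto simp: store_def eq_off_def)
    next
      fix s1
      assume s1: "s1 ''best'' 0 = gain (candidate k) \<and> eq_off {''best''} s s1"
      then have r1: "reads_input s1" using r by (auto elim: reads_input_eq_off)
      show "achieves Z (Fill ''X'' ''j'' (Var ''n'') Skip (Read ''Y'' (Var ''j''))) s1 (4 * n + 2)
          (\<lambda>s'. best_among (Suc k) s')"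
      proof (rule achieves_weaken[OF achieves_Fill_Skip[where
              f = "\<lambda>v. of_bool (v \<in> candidate k)" and n = n]])
        fix j s2
        assume off2: "eq_off {''X'', ''j''} s1 s2"
        with r1 have r2: "reads_input s2" by (rule reads_input_eq_off) auto
        show "val (Var ''n'') s2 = n" using r2 by (simp add: reads_input_simps)
        assume j: "j < n" "s2 ''j'' 0 = j"
        have "s2 ''Y'' = s ''Y''" using s1 off2 by (auto simp: eq_off_def)
        then show "val (Read ''Y'' (Var ''j'')) s2 = of_bool (j \<in> candidate k)" using j Y by simp
      next
        fix s2
        assume s2: "(\<forall>j<n. s2 ''X'' j = of_bool (j \<in> candidate k)) \<and> eq_off {''X'', ''j''} s1 s2"
        then have "s2 ''best'' 0 = gain (candidate k)" using s1 by (auto simp: eq_off_def)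
        moreover have "\<forall>j<Suc k. fits (candidate j) \<longrightarrow> gain (candidate j) \<le> gain (candidate k)"
          using S(5) better(2) by (force simp: less_Suc_eq)
        ultimately show "best_among (Suc k) s2"
          unfolding best_among_def using s2 better(1) candidate_subset by blast
      next
        fix j
        assume "j < n"
        then show "of_bool (j \<in> candidate k) \<le> Z" using n_less by simp
      qed (use n_less in auto)
    qed
  next
    assume "val (Op Times (Le (Var ''f'') (Const 0)) (Op Minus (Var ''o'') (Var ''best''))) s = 0"
    then have "fits (candidate k) \<longrightarrow> gain (candidate k) \<le> gain S" using f o S(4) by auto
    then have "best_among (Suc k) s"
      unfolding best_among_def using S by (intro exI[of _ S]) (auto simp: less_Suc_eq)
    then have "achieves Z Skip s 1 (best_among (Suc k))"
      by (intro achieves_Skip[where Q = "best_among (Suc k)"])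
    then show "achieves Z Skip s (1 + (4 * n + 2)) (\<lambda>s'. best_among (Suc k) s')"
      by (rule achieves_weaken) simp_all
  qed
  then show ?thesis by (rule achieves_weaken) auto
qed

definition num_candidates :: nat where "num_candidates = 2 * n * ((n + 1) * (n + 1))"

definition step_bound :: nat where
  "step_bound = (4 * n + 2) + ((p * (4 * n + 6) + 3) + ((n * (4 * n + 6) + 3) + (4 * n + 4)))"

lemma achieves_enumerate_candidates:
  assumes "prepared s" "best_among 0 s"
  shows "achieves Z enumerate_candidates s (num_candidates * (step_bound + 2) + 2)
    (best_among num_candidates)"
proof -
  let ?J = "\<lambda>k s'. prepared s' \<and> best_among k s'"
  have "achieves Z enumerate_candidates s (num_candidates * (step_bound + 2) + 2)
      (\<lambda>s'. s' ''k'' 0 = num_candidates \<and> ?J num_candidates s')"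
    unfolding enumerate_candidates_def
  proof (rule achieves_For)
    fix k s1
    assume J: "?J k s1" and k: "k < num_candidates" "s1 ''k'' 0 = k"
    let ?S = "candidate k"
    let ?Y = "\<lambda>s'. \<forall>v<n. s' ''Y'' v = of_bool (v \<in> ?S)"
    have "achieves Z (Seq build_candidate (Seq count_violations (Seq compute_objective keep_better)))
        s1 step_bound (\<lambda>s'. best_among (Suc k) s')"
      unfolding step_bound_def
    proof (intro achieves_Seq)
      show "achieves Z build_candidate s1 (4 * n + 2) (\<lambda>s'. ?Y s' \<and> eq_off {''Y'', ''j''} s1 s')"
        using achieves_eq_off[OF achieves_build_candidate[of s1]] J k by simp
    next
      fix s2
      assume s2: "?Y s2 \<and> eq_off {''Y'', ''j''} s1 s2"
      have J2: "?J k s2"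
        using prepared_eq_off[OF conjunct1[OF J] conjunct2[OF s2]]
          best_among_eq_off[OF conjunct2[OF J] conjunct2[OF s2]] by simp
      show "achieves Z count_violations s2 (p * (4 * n + 6) + 3)
          (\<lambda>s'. (s' ''f'' 0 = 0 \<longleftrightarrow> fits ?S) \<and> ?J k s' \<and> ?Y s')"
      proof (intro achieves_weaken[OF achieves_eq_off[OF achieves_count_violations[of s2 ?S]]])
        fix s'
        assume s': "(s' ''f'' 0 = 0 \<longleftrightarrow> fits ?S) \<and> eq_off (written count_violations) s2 s'"
        have "prepared s'" using conjunct1[OF J2] conjunct2[OF s'] by (rule prepared_eq_off) simp
        moreover have "best_among k s'"
          using conjunct2[OF J2] conjunct2[OF s'] by (rule best_among_eq_off) simp
        moreover have "?Y s'" using s2 s' by (simp add: eq_off_def)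
        ultimately show "(s' ''f'' 0 = 0 \<longleftrightarrow> fits ?S) \<and> ?J k s' \<and> ?Y s'" using s' by blast
      qed (use J2 s2 candidate_subset[of k] in \<open>simp_all add: prepared_def\<close>)
    next
      fix s3
      assume s3: "(s3 ''f'' 0 = 0 \<longleftrightarrow> fits ?S) \<and> ?J k s3 \<and> ?Y s3"
      then have J3: "prepared s3" "best_among k s3" and f3: "s3 ''f'' 0 = 0 \<longleftrightarrow> fits ?S"
        by (simp_all only: simp_thms)
      have Y3: "?Y s3" using conjunct2[OF conjunct2[OF s3]] .
      show "achieves Z compute_objective s3 (n * (4 * n + 6) + 3)
          (\<lambda>s'. s' ''o'' 0 = gain ?S \<and> (s' ''f'' 0 = 0 \<longleftrightarrow> fits ?S) \<and> ?J k s' \<and> ?Y s')"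
      proof (intro achieves_weaken[OF achieves_eq_off[OF achieves_compute_objective[of s3 ?S]]])
        fix s'
        assume s': "s' ''o'' 0 = gain ?S \<and> eq_off (written compute_objective) s3 s'"
        have "prepared s'" using J3(1) conjunct2[OF s'] by (rule prepared_eq_off) simp
        moreover have "best_among k s'"
          using J3(2) conjunct2[OF s'] by (rule best_among_eq_off) simp
        moreover have "s' ''Y'' = s3 ''Y''" "s' ''f'' = s3 ''f''" using s' by (simp_all add: eq_off_def)
        ultimately show "s' ''o'' 0 = gain ?S \<and> (s' ''f'' 0 = 0 \<longleftrightarrow> fits ?S) \<and> ?J k s' \<and> ?Y s'"
          using s' f3 Y3 by simp
      qed (use J3 Y3 candidate_subset[of k] in \<open>simp_all add: prepared_def\<close>)
    next
      fix s4
      assume "s4 ''o'' 0 = gain ?S \<and> (s4 ''f'' 0 = 0 \<longleftrightarrow> fits ?S) \<and> ?J k s4 \<and> ?Y s4"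
      then show "achieves Z keep_better s4 (4 * n + 4) (\<lambda>s'. best_among (Suc k) s')"
        by (intro achieves_keep_better) (auto simp: prepared_def)
    qed
    from achieves_eq_off[OF this]
    show "achieves Z (Seq build_candidate (Seq count_violations (Seq compute_objective keep_better)))
        s1 step_bound (\<lambda>s''. s'' ''k'' 0 = k \<and> ?J (Suc k) (store ''k'' 0 (Suc k) s''))"
    proof (rule achieves_weaken)
      fix s''
      assume s'': "best_among (Suc k) s'' \<and> eq_off (written (Seq build_candidate
          (Seq count_violations (Seq compute_objective keep_better)))) s1 s''"
      have off: "eq_off {''k''} s'' (store ''k'' 0 (Suc k) s'')" by (auto simp: store_def eq_off_def)
      have "prepared s''" using conjunct1[OF J] conjunct2[OF s''] by (rule prepared_eq_off) simp
      then have "prepared (store ''k'' 0 (Suc k) s'')" using off by (rule prepared_eq_off) simp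
      moreover have "best_among (Suc k) (store ''k'' 0 (Suc k) s'')"
        using conjunct1[OF s''] off by (rule best_among_eq_off) simp
      moreover have "s'' ''k'' 0 = k" using s'' k by (auto simp: eq_off_def)
      ultimately show "s'' ''k'' 0 = k \<and> ?J (Suc k) (store ''k'' 0 (Suc k) s'')" by blast
    qed simp
  next
    have off: "eq_off {''k''} s (store ''k'' 0 0 s)" by (auto simp: store_def eq_off_def)
    show "?J 0 (store ''k'' 0 0 s)"
      using prepared_eq_off[OF assms(1) off] best_among_eq_off[OF assms(2) off] by simp
  next
    fix k s'
    assume "?J k s'"
    then have "s' ''n'' 0 = n" by (simp add: prepared_def reads_input_simps)
    then show "val (Op Times (Op Times (Const 2) (Var ''n'')) NN_expr) s' = num_candidates"
      by (simp add: num_candidates_def NN_expr_def N_expr_def)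
  qed (use loops_le in \<open>simp add: num_candidates_def\<close>)
  then show ?thesis by (rule achieves_weaken) auto
qed

lemma achieves_program:
  "achieves Z program init
    ((3 * p + 3) + ((n * (4 * p + 6) + 2) + ((n * (4 * n + 6) + 2) + (num_candidates * (step_bound + 2) + 2))))
    (best_among num_candidates)"
proof -
  have init: "reads_input init" by (simp add: reads_input_def)
  have "best_among 0 init"
    unfolding best_among_def
    by (intro exI[of _ "{}"]) (auto simp: fits_def gain_def init_best init_X)
  note base = init this
  show ?thesis
    unfolding program_def
  proof (intro achieves_Seq)
    show "achieves Z compute_scale init (3 * p + 3)
        (\<lambda>s. reads_input s \<and> best_among 0 s \<and> s ''D'' 0 = scale)"
    proof (rule achieves_weaken[OF achieves_eq_off[OF achieves_compute_scale[OF init]]])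
      fix s
      assume s: "s ''D'' 0 = scale \<and> eq_off (written compute_scale) init s"
      then show "reads_input s \<and> best_among 0 s \<and> s ''D'' 0 = scale"
        using reads_input_eq_off[OF base(1) conjunct2[OF s]] best_among_eq_off[OF base(2) conjunct2[OF s]]
        by simp
    qed simp
  next
    fix s
    assume s: "reads_input s \<and> best_among 0 s \<and> s ''D'' 0 = scale"
    then have base: "reads_input s" "best_among 0 s" and D: "s ''D'' 0 = scale" by (simp_all only: simp_thms)
    show "achieves Z compute_weights s (n * (4 * p + 6) + 2)
        (\<lambda>s'. reads_input s' \<and> best_among 0 s' \<and> s' ''D'' 0 = scale \<and> (\<forall>v<n. s' ''w'' v = weight v))"
    proof (rule achieves_weaken[OF achieves_eq_off[OF achieves_compute_weights[OF base(1) D]]])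
      fix s'
      assume s': "(\<forall>v<n. s' ''w'' v = weight v) \<and> eq_off (written compute_weights) s s'"
      then have "s' ''D'' = s ''D''" by (simp add: eq_off_def)
      then show "reads_input s' \<and> best_among 0 s' \<and> s' ''D'' 0 = scale \<and> (\<forall>v<n. s' ''w'' v = weight v)"
        using reads_input_eq_off[OF base(1) conjunct2[OF s']]
          best_among_eq_off[OF base(2) conjunct2[OF s']] s' D
        by simp
    qed simp
  next
    fix s
    assume s: "reads_input s \<and> best_among 0 s \<and> s ''D'' 0 = scale \<and> (\<forall>v<n. s ''w'' v = weight v)"
    then have base: "reads_input s" "best_among 0 s" and D: "s ''D'' 0 = scale"
      by (simp_all only: simp_thms)
    have w: "\<forall>v<n. s ''w'' v = weight v" using conjunct2[OF conjunct2[OF conjunct2[OF s]]] .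
    show "achieves Z compute_degrees s (n * (4 * n + 6) + 2) (\<lambda>s'. prepared s' \<and> best_among 0 s')"
    proof (rule achieves_weaken[OF achieves_eq_off[OF achieves_compute_degrees[OF base(1) D w]]])
      fix s'
      assume s': "(\<forall>v<n. s' ''d'' v = deg v) \<and> eq_off (written compute_degrees) s s'"
      then have "s' ''D'' = s ''D''" "s' ''w'' = s ''w''" by (simp_all add: eq_off_def)
      then show "prepared s' \<and> best_among 0 s'"
        using reads_input_eq_off[OF base(1) conjunct2[OF s']]
          best_among_eq_off[OF base(2) conjunct2[OF s']] s' D w
        by (simp add: prepared_def)
    qed simp
  next
    fix s
    assume "prepared s \<and> best_among 0 s"
    then show "achieves Z enumerate_candidates s (num_candidates * (step_bound + 2) + 2)
        (best_among num_candidates)"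
      by (intro achieves_enumerate_candidates) auto
  qed
qed

end

section \<open>Quality of the best candidate\<close>

text \<open>A difference of at least one in the leading digit outweighs any last digit below
  \<open>N\<close>.\<close>

lemma lexicographic_encoding:
  fixes a b v u N :: nat
  assumes "v < N" "u < N"
  shows "a * N + v \<le> b * N + u \<longleftrightarrow> a < b \<or> a = b \<and> v \<le> u"
proof -
  have "a * N + v < b * N + w" if "a < b" "v < N" for a b v w :: nat
  proof -
    have "a * N + v < (a + 1) * N" using that by simp
    also have "\<dots> \<le> b * N" using that by (intro mult_right_mono) auto
    finally show ?thesis by simp
  qed
  from this[of a b v u] this[of b a u v] assms show ?thesis
    by (cases a b rule: linorder_cases) auto
qed

context bounded_machine_input begin

lemma candidate_pair_interval:
  assumes "u < n" "x \<le> n" "y \<le> n"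
  obtains k where "k < num_candidates" "candidate k = insert u {x..<y}"
proof -
  obtain k where k: "k < num_candidates" "decode_mode n k = 1" "decode_pivot n k = u"
      "decode_left n k = x" "decode_right n k = y"
    using decode_exists[of 1 u n x y] assms by (auto simp: num_candidates_def)
  have "candidate k = insert u {x..<y}" using k assms by (auto simp: candidate_def)
  with k(1) show ?thesis by (rule that)
qed

lemma candidate_prefix_interval:
  assumes "u < n" "x \<le> n" "y \<le> n"
  obtains k where "k < num_candidates"
    "candidate k = {v. v < n \<and> light v \<and> (precedes v u \<or> v \<in> {x..<y})}"
proof -
  obtain k where k: "k < num_candidates" "decode_mode n k = 0" "decode_pivot n k = u"
      "decode_left n k = x" "decode_right n k = y"
    using decode_exists[of 0 u n x y] assms by (auto simp: num_candidates_def)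
  have "candidate k = {v. v < n \<and> light v \<and> (precedes v u \<or> v \<in> {x..<y})}"
    using k by (auto simp: candidate_def)
  with k(1) show ?thesis by (rule that)
qed

lemma gain_mono: "S \<subseteq> T \<Longrightarrow> finite T \<Longrightarrow> gain S \<le> gain T"
  unfolding gain_def
  by (intro order_trans[OF sum_mono sum_mono2] add_left_mono sum_mono2) (auto dest: finite_subset)

lemma fits_mono: "S \<subseteq> T \<Longrightarrow> finite T \<Longrightarrow> fits T \<Longrightarrow> fits S"
  unfolding fits_def by (meson mult_le_mono2 order_trans sum_mono2 zero_le)

section \<open>Item weights and feasibility\<close>

definition load_fraction :: "nat \<Rightarrow> real" where
  "load_fraction v = (\<Sum>i<p. real (entry i v) * real (den i) / real (num i))"

lemma scale_pos: "0 < scale"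
  unfolding scale_def by (intro prod_pos) (auto simp: num_pos)

lemma weight_eq: "real (weight v) = scale * load_fraction v"
proof -
  \<comment> \<open>Each \<open>num i\<close> is a factor of \<open>scale\<close>, so the integer
    division is exact.\<close>
  have "real (scale div num i) = scale / num i" if "i < p" for i
    using that unfolding scale_def by (intro real_of_nat_div dvd_prodI) auto
  then show ?thesis
    by (auto simp: weight_def load_fraction_def sum_distrib_left intro!: sum.cong)
qed

lemma load_fraction_nonneg: "0 \<le> load_fraction v"
  by (auto simp: load_fraction_def intro: sum_nonneg)

lemma sum_load_fraction:
  "sum load_fraction S = (\<Sum>i<p. real (den i * (\<Sum>v\<in>S. entry i v)) / real (num i))"
  unfolding load_fraction_def
  by (subst sum.swap) (simp add: sum_divide_distrib sum_distrib_left mult.commute)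

text \<open>The relative load of one constraint is a summand of the total weight, and all other
  summands are nonnegative.\<close>

lemma fits_if_load_le_1:
  assumes "sum load_fraction S \<le> 1"
  shows "fits S"
  unfolding fits_def
proof (intro allI impI)
  fix i
  assume i: "i < p"
  let ?l = "\<lambda>i. real (den i * (\<Sum>v\<in>S. entry i v)) / real (num i)"
  have "?l i \<le> sum ?l {..<p}" using i by (intro member_le_sum) (auto intro!: divide_nonneg_nonneg mult_nonneg_nonneg sum_nonneg)
  then have "?l i \<le> 1" using assms by (simp only: sum_load_fraction)
  then have "real (den i * (\<Sum>v\<in>S. entry i v)) \<le> real (num i)" using num_pos[OF i] by simp
  then show "den i * (\<Sum>v\<in>S. entry i v) \<le> num i" by (simp only: of_nat_le_iff)
qed

text \<open>Each of the \<open>p\<close> constraints contributes a relative load of at most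
  1.\<close>

lemma load_le_if_fits:
  assumes "fits S"
  shows "sum load_fraction S \<le> p"
proof -
  have "real (den i * (\<Sum>v\<in>S. entry i v)) / real (num i) \<le> 1" if "i < p" for i
  proof -
    have "real (den i * (\<Sum>v\<in>S. entry i v)) \<le> real (num i)"
      using assms that by (simp only: of_nat_le_iff fits_def)
    then show ?thesis using num_pos[OF that] by simp
  qed
  then have "(\<Sum>i<p. real (den i * (\<Sum>v\<in>S. entry i v)) / real (num i)) \<le> (\<Sum>i<p. 1)"
    by (intro sum_mono) auto
  then show ?thesis by (simp add: sum_load_fraction)
qed

text \<open>If not all items fit together, then \<open>n a > b\<close>, which is the lower bound on \<open>R\<close> required above.\<close>
theorem best_candidate_approximates:
  assumes lin_pos: "\<And>v. v < n \<Longrightarrow> 0 < cost_lin v" and den_pos: "\<And>i. i < p \<Longrightarrow> 0 < den i"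
    and a: "\<And>i v. i < p \<Longrightarrow> v < n \<Longrightarrow> entry i v \<le> a"
    and b: "0 < b" "\<And>i. i < p \<Longrightarrow> b \<le> real (num i) / real (den i)"
    and best: "\<And>k. k < num_candidates \<Longrightarrow> fits (candidate k) \<Longrightarrow> gain (candidate k) \<le> G"
    and T: "T \<subseteq> {..<n}" "fits T"
  shows "real (gain T) \<le> max 1 (78 * (real p)\<^sup>2 * (real n * real a / b)) * real G"
proof (cases "fits {..<n}")
  case True
  have "gain T \<le> G"
  \<comment> \<open>A pivot must be below \<open>n\<close>, so the instance without items is treated
    apart; there every gain is 0.\<close>
  proof (cases "n = 0")
    case False
    then obtain k where k: "k < num_candidates" "candidate k = insert 0 {0..<n}"
      using candidate_pair_interval[of 0 0 n] by auto
    have "insert 0 {0..<n} = {..<n}"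
      using False by (simp add: lessThan_atLeast0 insert_absorb)
    with k(2) have "candidate k = {..<n}" by (rule trans)
    then show ?thesis using best[OF k(1)] True gain_mono[OF T(1)] by simp
  qed (use T in \<open>simp add: gain_def\<close>)
  then have "1 * real (gain T) \<le> max 1 (78 * (real p)\<^sup>2 * (real n * real a / b)) * real G"
    by (intro mult_mono) auto
  then show ?thesis by simp
next
  case False
  then obtain i where i: "i < p" "num i < den i * (\<Sum>v<n. entry i v)" by (auto simp: fits_def not_le)
  let ?R = "real n * real a / b"
  have R: "1 \<le> ?R"
  proof -
    have "(\<Sum>v<n. entry i v) \<le> n * a" using sum_bounded_above[of "{..<n}" "entry i" a] a i by simp
    then have "num i \<le> den i * (n * a)"
      using i(2) mult_le_mono2[of "\<Sum>v<n. entry i v" "n * a" "den i"] by linarith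
    then have "real (num i) \<le> real (den i) * (real n * real a)" by (metis of_nat_le_iff of_nat_mult)
    then have "real (num i) / real (den i) \<le> real n * real a"
      using den_pos[OF i(1)] by (simp add: field_simps)
    then have "b \<le> real n * real a" using b(2)[OF i(1)] by simp
    then show ?thesis using b(1) by simp
  qed
  interpret quadratic_knapsack n load_fraction "\<lambda>v. real (cost_lin v)" "\<lambda>u v. real (cost_quad u v)"
    by unfold_locales (use lin_pos load_fraction_nonneg in auto)
  have light_iff: "light v \<longleftrightarrow> 4 * load_fraction v \<le> 1" for v
  proof -
    have "light v \<longleftrightarrow> real (4 * weight v) \<le> real scale" by (simp only: light_def of_nat_le_iff)
    also have "\<dots> \<longleftrightarrow> scale * (4 * load_fraction v) \<le> real scale * 1" by (simp add: weight_eq mult_ac)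
    also have "\<dots> \<longleftrightarrow> 4 * load_fraction v \<le> 1" using scale_pos by (intro mult_le_cancel_left_pos) simp
    finally show ?thesis .
  qed
  have small_eq: "small = {v. v < n \<and> light v}" by (auto simp: small_def light_iff)
  have degree_eq: "degree u = real (deg u)" for u
  proof -
    have "(\<Sum>v<n. cost_quad u v * of_bool (light v)) = (\<Sum>v\<in>small. cost_quad u v)"
      by (auto simp: small_eq intro!: sum.mono_neutral_cong_right)
    then show ?thesis by (simp add: degree_def deg_def del: sum_mult_of_bool_eq)
  qed
  have worth_eq: "worth U = real (gain U)" for U by (simp add: worth_def gain_def)
  \<comment> \<open>The positive factor \<open>scale\<close> cancels, so the integer comparison of
    the program agrees with the order by real ratios.\<close>
  have before_eq: "before v u \<longleftrightarrow> precedes v u" if "v < n" "u < n" for u v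
  proof -
    have cmp: "load_fraction v * degree u < load_fraction u * degree v \<longleftrightarrow> weight v * deg u < weight u * deg v"
      for u v
    proof -
      have "weight v * deg u < weight u * deg v \<longleftrightarrow>
          real (weight v) * real (deg u) < real (weight u) * real (deg v)"
        by (metis of_nat_less_iff of_nat_mult)
      also have "\<dots> \<longleftrightarrow> scale * (load_fraction v * degree u) < scale * (load_fraction u * degree v)"
        by (simp only: weight_eq degree_eq mult.assoc)
      finally show ?thesis using scale_pos by simp
    qed
    have "load_fraction v * degree u = load_fraction u * degree v \<longleftrightarrow>
        weight v * deg u = weight u * deg v"
      using cmp[of v u] cmp[of u v] by (metis less_irrefl linorder_neqE)
    then show ?thesis
      unfolding before_def precedes_def cmp[of v u]
      using that lexicographic_encoding[of v "n + 1" u "weight v * deg u" "weight u * deg v"] by simp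
  qed
  have "worth T \<le> 78 * (real p)\<^sup>2 * ?R * real G"
  proof (rule worth_le_best_candidate[OF _ R])
    show "1 \<le> real p" using i(1) by simp
  next
    fix v
    assume v: "v < n"
    \<comment> \<open>Entries are at most \<open>a\<close> and bounds at least \<open>b\<close>;
      summing over the constraints gives the weight hypothesis with \<open>P = p\<close> and
      \<open>R = n * a / b\<close>.\<close>
    have "real (entry i v) * real (den i) / real (num i) \<le> real a / b" if "i < p" for i
    proof -
      have "b * real (den i) \<le> real (num i)" using b(2)[OF that] den_pos[OF that] by (simp add: field_simps)
      then have "real (entry i v) * (b * real (den i)) \<le> real a * real (num i)"
        using a[OF that v] b(1) by (intro mult_mono) auto
      then show ?thesis using b(1) num_pos[OF that] by (simp add: field_simps)
    qed
    then have "load_fraction v \<le> (\<Sum>i<p. real a / b)" unfolding load_fraction_def by (intro sum_mono) auto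
    then have "real n * load_fraction v \<le> real n * (real p * (real a / b))"
      by (intro mult_left_mono) auto
    then show "real n * load_fraction v \<le> real p * ?R" by (simp add: mult_ac)
  next
    fix u v
    assume uv: "u \<in> T" "v \<in> T"
    then have "u < n" "v \<le> n" "Suc v \<le> n" using T(1) by auto
    then obtain k where k: "k < num_candidates" "candidate k = insert u {v..<Suc v}"
      by (rule candidate_pair_interval)
    then have "candidate k = {u, v}" by simp
    \<comment> \<open>Entries are nonnegative, so the pair inherits feasibility from
      \<open>T\<close>.\<close>
    moreover have "fits {u, v}"
      using fits_mono[OF _ _ T(2), of "{u, v}"] uv T(1) finite_subset by auto
    ultimately show "worth {u, v} \<le> real G" using best[OF k(1)] by (simp add: worth_eq)
  next
    fix u x y
    assume u: "u \<in> small" and y: "y \<le> n" and le: "sum load_fraction (prefix u \<union> {x..<y} \<inter> small) \<le> 1"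
    then have un: "u < n" by (simp add: small_def)
    \<comment> \<open>An encoded left end is at most \<open>n\<close>; capping \<open>x\<close>
      there does not change the interval, because \<open>y \<le> n\<close>.\<close>
    obtain k where k: "k < num_candidates"
      "candidate k = {v. v < n \<and> light v \<and> (precedes v u \<or> v \<in> {min x n..<y})}"
      using candidate_prefix_interval[OF un _ y, of "min x n"] by auto
    have "candidate k = prefix u \<union> {x..<y} \<inter> small"
      unfolding k(2) using before_eq un y by (auto simp: prefix_def small_eq)
    then show "worth (prefix u \<union> {x..<y} \<inter> small) \<le> real G"
      using best[OF k(1)] fits_if_load_le_1[OF le] by (simp add: worth_eq)
  qed (use T load_le_if_fits in auto)
  then show ?thesis
    unfolding worth_eq by (rule order_trans) (intro mult_right_mono, auto)
qed

end

section \<open>Running time on instances\<close>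

definition numer :: "piqp \<Rightarrow> nat \<Rightarrow> nat" where
  "numer I i = nat (fst (quotient_of (bound I $ i)))"

definition denom :: "piqp \<Rightarrow> nat \<Rightarrow> nat" where
  "denom I i = nat (snd (quotient_of (bound I $ i)))"

lemma bound_fraction:
  assumes "is_piqp I" "i < nconstr I"
  shows "bound I $ i = of_nat (numer I i) / of_nat (denom I i)" "0 < numer I i" "0 < denom I i"
proof -
  obtain a d where q: "quotient_of (bound I $ i) = (a, d)" by fastforce
  have d: "0 < d" using quotient_of_denom_pos[OF q] .
  have eq: "bound I $ i = of_int a / of_int d" using quotient_of_div[OF q] .
  have "0 < bound I $ i" using assms by (simp add: is_piqp_def)
  then have a: "0 < a" using d unfolding eq by (simp add: zero_less_divide_iff)
  show "0 < numer I i" "0 < denom I i" using a d q by (simp_all add: numer_def denom_def)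
  show "bound I $ i = of_nat (numer I i) / of_nat (denom I i)"
    using a d q by (simp add: numer_def denom_def eq)
qed

lemma flat_index_less: "i < p \<Longrightarrow> v < n \<Longrightarrow> i * n + v < p * n" for i p v n :: nat
  using mult_le_mono1[of "Suc i" p n] by simp

lemma flat_index_div: "v < n \<Longrightarrow> (i * n + v) div n = i" for i v n :: nat
  by (metis add.commute div_less div_mult_self1 less_nat_zero_code add_0_right)

lemma machine_input_load:
  "machine_input (load I) (nvars I) (nconstr I) (\<lambda>v. lin I $ v) (numer I) (denom I)
     (\<lambda>i v. constr I $$ (i, v)) (\<lambda>u v. quad I $$ (u, v))"
  by unfold_locales (simp_all add: load_def Let_def flat_index_less flat_index_div numer_def denom_def)

text \<open>Cells outside the input hold 0, so a nonzero cell is among those that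
  \<open>input_size\<close> counts.\<close>

lemma one_plus_bits_load_le:
  assumes "0 < load I x k"
  shows "1 + bits (load I x k) \<le> input_size I"
proof -
  let ?cell = "\<lambda>x k. 1 + bits (load I x k)"
  have mem: "?cell y j \<le> (\<Sum>k<N. ?cell y k)" if "j < N" for y j N
    using member_le_sum[of j "{..<N}" "?cell y"] that by simp
  have total: "input_size I = ?cell ''n'' 0 + ?cell ''p'' 0 + (\<Sum>k<nvars I * nvars I. ?cell ''B'' k) +
      (\<Sum>k<nvars I. ?cell ''c'' k) + (\<Sum>k<nconstr I * nvars I. ?cell ''A'' k) +
      (\<Sum>k<nconstr I. ?cell ''Wnum'' k) + (\<Sum>k<nconstr I. ?cell ''Wden'' k)"
    by (simp only: input_size_def Let_def)
  consider "x = ''n''" "k = 0" | "x = ''p''" "k = 0" | "x = ''B''" "k < nvars I * nvars I"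
    | "x = ''c''" "k < nvars I" | "x = ''A''" "k < nconstr I * nvars I"
    | "x = ''Wnum''" "k < nconstr I" | "x = ''Wden''" "k < nconstr I"
    using assms by (auto simp: load_def Let_def split: if_splits)
  then show ?thesis
  proof cases
    case 1
    show ?thesis unfolding 1 using total by linarith
  next
    case 2
    show ?thesis unfolding 2 using total by linarith
  next
    case 3
    show ?thesis unfolding 3(1) using total mem[OF 3(2), of "''B''"] by linarith
  next
    case 4
    show ?thesis unfolding 4(1) using total mem[OF 4(2), of "''c''"] by linarith
  next
    case 5
    show ?thesis unfolding 5(1) using total mem[OF 5(2), of "''A''"] by linarith
  next
    case 6
    show ?thesis unfolding 6(1) using total mem[OF 6(2), of "''Wnum''"] by linarith
  next
    case 7
    show ?thesis unfolding 7(1) using total mem[OF 7(2), of "''Wden''"] by linarith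
  qed
qed

lemma cells_le_load: "cells_le (2 ^ input_size I) (load I)"
  unfolding cells_le_def
proof (intro allI)
  fix x k
  show "load I x k \<le> 2 ^ input_size I"
  proof (cases "load I x k = 0")
    case False
    then have "bits (load I x k) \<le> input_size I" using one_plus_bits_load_le[of I x k] by simp
    then show ?thesis by (simp add: bits_le_iff)
  qed simp
qed

lemma dimensions_le_input_size: "nvars I \<le> input_size I" "nconstr I \<le> input_size I"
proof -
  have "(\<Sum>k<N. 1) \<le> (\<Sum>k<N. 1 + bits (load I x k))" for x N by (intro sum_mono) simp
  from this[of "nvars I" "''c''"] this[of "nconstr I" "''Wnum''"]
  show "nvars I \<le> input_size I" "nconstr I \<le> input_size I"
    unfolding input_size_def Let_def by simp_all
qed

text \<open>Binary lengths add under multiplication, and \<open>input_size\<close> counts every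
  numerator separately. Thus the common scale is no longer than the input itself.\<close>

lemma prod_numer_le: "(\<Prod>i<nconstr I. numer I i) \<le> 2 ^ input_size I"
proof -
  have "(\<Prod>i<nconstr I. numer I i) \<le> (\<Prod>i<nconstr I. 2 ^ bits (numer I i))"
    by (intro prod_mono) (auto intro: less_imp_le less_two_power_bits)
  also have "\<dots> = 2 ^ (\<Sum>i<nconstr I. bits (numer I i))" by (simp add: power_sum)
  also have "(\<Sum>i<nconstr I. bits (numer I i)) \<le> (\<Sum>i<nconstr I. 1 + bits (load I ''Wnum'' i))"
    by (intro sum_mono) (simp add: load_def numer_def)
  also have "\<dots> \<le> input_size I" unfolding input_size_def Let_def by simp
  finally show ?thesis by simp
qed

text \<open>\<open>K = 2 ^ input_size I\<close> bounds each input cell, both dimensions and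
  \<open>scale\<close>. Every other quantity in question is at most \<open>K ^ 4\<close>, a product
  of at most four such numbers, where \<open>2 \<le> K\<close> absorbs the constant factors.\<close>

lemma bounded_machine_input_load:
  assumes I: "is_piqp I"
  shows "bounded_machine_input (load I) (nvars I) (nconstr I) (\<lambda>v. lin I $ v) (numer I) (denom I)
     (\<lambda>i v. constr I $$ (i, v)) (\<lambda>u v. quad I $$ (u, v)) (2 ^ (6 * input_size I))"
proof -
  interpret machine_input "load I" "nvars I" "nconstr I" "\<lambda>v. lin I $ v" "numer I" "denom I"
    "\<lambda>i v. constr I $$ (i, v)" "\<lambda>u v. quad I $$ (u, v)"
    by (rule machine_input_load)
  let ?n = "nvars I" and ?p = "nconstr I"
  define K :: nat where "K = 2 ^ input_size I"
  have Z: "2 ^ (6 * input_size I) = K ^ 6" unfolding K_def by (simp add: mult.commute flip: power_mult)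
  have size: "1 \<le> input_size I" by (simp add: input_size_def Let_def)
  have K: "2 \<le> K" using power_increasing[OF size, of "2::nat"] by (simp add: K_def)
  have le_Z: "a \<le> K ^ 6" if "a \<le> K ^ j" "j \<le> 6" for a j
    using K by (intro order_trans[OF that(1) power_increasing[OF that(2)]]) simp
  have n: "?n < K" and p: "?p < K"
    unfolding K_def
    using dimensions_le_input_size[of I] by (auto intro: le_less_trans[OF _ less_exp])
  have cell: "load I x k \<le> K" for x k using cells_le_load[of I] by (simp add: cells_le_def K_def)
  have lin: "lin I $ v \<le> K" if "v < ?n" for v
    using cell[of "''c''" v] init_c that by simp
  have quad: "quad I $$ (u, v) \<le> K" if "u < ?n" "v < ?n" for u v
    using cell[of "''B''" "u * ?n + v"] init_B[of u v] that by simp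
  have entry: "constr I $$ (i, v) \<le> K" if "i < ?p" "v < ?n" for i v
    using cell[of "''A''" "i * ?n + v"] init_A[of i v] that by simp
  have den: "denom I i \<le> K" if "i < ?p" for i
    using cell[of "''Wden''" i] init_den[of i] that by simp
  have scale: "scale \<le> K" unfolding scale_def K_def by (rule prod_numer_le)
  show ?thesis
  proof (unfold_locales, unfold Z)
    show "?n < K ^ 6" using le_Z[of "Suc ?n" 1] n by simp
    show "?p \<le> K ^ 6" using le_Z[of ?p 1] p by simp
    have "2 * ?n * ((?n + 1) * (?n + 1)) \<le> K * K * (K * K)" using K n by (intro mult_mono) auto
    then show "2 * ?n * ((?n + 1) * (?n + 1)) \<le> K ^ 6"
      by (intro le_Z[of _ 4]) (simp_all add: eval_nat_numeral mult.assoc)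
    show "0 < numer I i" if "i < ?p" for i using bound_fraction[OF I] that by simp
    show "scale \<le> K ^ 6" using le_Z[of _ 1] scale by simp
    show "weight v \<le> K ^ 6" if "v < ?n" for v
    proof -
      have "weight v \<le> (\<Sum>i<?p. K * K * K)"
        unfolding weight_def
        using entry den that scale
        by (intro sum_mono mult_mono) (auto intro: order_trans[OF div_le_dividend])
      also have "\<dots> \<le> K * (K * K * K)" using p by simp
      finally show ?thesis by (intro le_Z[of _ 4]) (simp_all add: eval_nat_numeral mult.assoc)
    qed
    have row: "(\<Sum>v<?n. f v) \<le> K * K" if "\<And>v. v < ?n \<Longrightarrow> f v \<le> K" for f
    proof -
      have "(\<Sum>v<?n. f v) \<le> ?n * K" using sum_bounded_above[of "{..<?n}" f K] that by simp
      also have "\<dots> \<le> K * K" using n by simp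
      finally show ?thesis .
    qed
    have square: "a \<le> K ^ 6" if "a \<le> K * K" for a
      using that by (intro le_Z[of _ 2]) (simp_all add: power2_eq_square)
    have cube: "a \<le> K ^ 6" if "a \<le> K * (K + K * K)" for a
    proof -
      have "K * (K + K * K) \<le> K * (K * K + K * K)" by simp
      also have "\<dots> = 2 * (K * (K * K))" by simp
      also have "\<dots> \<le> K * (K * (K * K))" using K by (intro mult_right_mono) auto
      finally have "K * (K + K * K) \<le> K ^ 4" by (simp only: power4_eq_xxxx mult.assoc)
      then show ?thesis using le_Z[OF order_trans[OF that]] by simp
    qed
    show "deg u \<le> K ^ 6" if u: "u < ?n" for u
    proof -
      have "(\<Sum>v<?n. quad I $$ (u, v) * of_bool (light v)) \<le> K * K"
        using quad[OF u] by (intro row) (auto simp: of_bool_def)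
      then have "deg u \<le> K * K + K" unfolding deg_def using lin[OF u] by simp
      also have "\<dots> \<le> K * (K + K * K)" using K by (simp add: algebra_simps)
      finally show ?thesis by (rule cube)
    qed
    show "(\<Sum>v<?n. constr I $$ (i, v)) \<le> K ^ 6" if "i < ?p" for i
      by (intro square row entry that)
    show "(\<Sum>v<?n. quad I $$ (u, v)) \<le> K ^ 6" if "u < ?n" for u
      by (intro square row quad that)
    show "gain S \<le> K ^ 6" if S: "S \<subseteq> {..<?n}" for S
    proof -
      have card: "card S \<le> K" using card_mono[OF _ S] n by simp
      have "(\<Sum>v\<in>S. quad I $$ (u, v)) \<le> K * K" if "u \<in> S" for u
      proof -
        have "(\<Sum>v\<in>S. quad I $$ (u, v)) \<le> (\<Sum>v<?n. quad I $$ (u, v))"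
          using S by (intro sum_mono2) auto
        also have "\<dots> \<le> K * K" using that S by (intro row quad) auto
        finally show ?thesis .
      qed
      then have "gain S \<le> of_nat (card S) * (K + K * K)"
        unfolding gain_def using S lin by (intro sum_bounded_above add_mono) auto
      also have "\<dots> \<le> K * (K + K * K)" using card by simp
      finally show ?thesis by (rule cube)
    qed
  qed
qed

text \<open>With \<open>T = input_size I + 1\<close>, the enumeration makes at most
  \<open>2 * T ^ 3\<close> rounds of at most \<open>35 * T ^ 2\<close> steps, and the remaining
  steps fit into \<open>30 * T ^ 5\<close>; this gives \<open>100 * T ^ 5\<close>. The length factor
  \<open>bits Z + 2\<close> is at most \<open>6 * T\<close>, whence 600 and the exponent 6.\<close>

lemma exec_program:
  assumes I: "is_piqp I"
  obtains s k where "\<And>t. exec program (load I, t) = return_spmf (s, t + k)"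
    "k \<le> 600 * com_size program * (input_size I + 1) ^ 6"
    "bounded_machine_input.best_among (nvars I) (nconstr I) (\<lambda>v. lin I $ v) (numer I) (denom I)
       (\<lambda>i v. constr I $$ (i, v)) (\<lambda>u v. quad I $$ (u, v))
       (bounded_machine_input.num_candidates (nvars I)) s"
proof -
  interpret bounded_machine_input "load I" "nvars I" "nconstr I" "\<lambda>v. lin I $ v" "numer I" "denom I"
    "\<lambda>i v. constr I $$ (i, v)" "\<lambda>u v. quad I $$ (u, v)" "2 ^ (6 * input_size I)"
    by (rule bounded_machine_input_load[OF I])
  define Z :: nat where "Z = 2 ^ (6 * input_size I)"
  define T where "T = input_size I + 1"
  have np: "nvars I + 1 \<le> T" "nconstr I \<le> T"
    using dimensions_le_input_size[of I] by (simp_all add: T_def)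
  obtain m s where m: "m \<le> (3 * nconstr I + 3) + ((nvars I * (4 * nconstr I + 6) + 2) +
        ((nvars I * (4 * nvars I + 6) + 2) + (num_candidates * (step_bound + 2) + 2)))"
      and r: "reaches Z program (load I) m s" and best: "best_among num_candidates s"
    using achieves_program unfolding achieves_def Z_def by blast
  have "(2::nat) ^ input_size I \<le> Z" unfolding Z_def by (intro power_increasing) auto
  then have cells: "cells_le Z (load I)"
    using cells_le_load[of I] unfolding cells_le_def by (blast intro: order_trans)
  obtain k where k: "k \<le> m * com_size program * (bits Z + 2)"
      "\<And>t. exec program (load I, t) = return_spmf (s, t + k)"
    using reaches_exec[OF r cells] by blast
  have T1: "1 \<le> T" by (simp add: T_def)
  have m_le: "m \<le> 100 * T ^ 5"
  proof -
    have sq: "T \<le> T * T" "1 \<le> T * T" using T1 by simp_all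
    have prod: "nvars I * nvars I \<le> T * T" "nvars I * nconstr I \<le> T * T"
      using np by (auto intro!: mult_mono)
    have nc: "num_candidates \<le> 2 * T ^ 3"
    proof -
      have "num_candidates \<le> 2 * T * (T * T)"
        unfolding num_candidates_def using np by (intro mult_mono) auto
      then show ?thesis by (simp add: power3_eq_cube mult.assoc)
    qed
    have "step_bound + 2 = 14 + 6 * nconstr I + 14 * nvars I + 4 * (nvars I * nvars I) +
        4 * (nvars I * nconstr I)"
      by (simp add: step_bound_def algebra_simps)
    then have "step_bound + 2 \<le> 35 * (T * T)" using np sq prod by linarith
    then have main: "num_candidates * (step_bound + 2) \<le> (2 * T ^ 3) * (35 * (T * T))"
      using nc by (intro mult_mono) auto
    have T5: "(2 * T ^ 3) * (35 * (T * T)) = 70 * T ^ 5"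
      using power_add[of T 3 2] by (simp add: power2_eq_square)
    have "T ^ 2 \<le> T ^ 5" using T1 by (intro power_increasing) auto
    then have "T * T \<le> T ^ 5" by (simp add: power2_eq_square)
    moreover have "m \<le> 9 + 3 * nconstr I + 12 * nvars I + 4 * (nvars I * nconstr I) +
        4 * (nvars I * nvars I) + num_candidates * (step_bound + 2)"
      using m by (simp add: algebra_simps)
    ultimately show ?thesis using main[unfolded T5] np sq prod by linarith
  qed
  have "bits Z \<le> 6 * input_size I + 1" unfolding bits_le_iff Z_def by simp
  then have "bits Z + 2 \<le> 6 * T" by (simp add: T_def)
  with m_le have "m * com_size program * (bits Z + 2) \<le> (100 * T ^ 5) * com_size program * (6 * T)"
    by (intro mult_mono) auto
  also have "\<dots> = 600 * com_size program * T ^ 6" using power_Suc2[of T 5] by simp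
  finally have "k \<le> 600 * com_size program * T ^ 6" using k(1) by simp
  then show ?thesis using that[OF k(2)] best unfolding T_def by blast
qed

lemma polynomial_time_program: "polynomial_time program"
  unfolding polynomial_time_def
proof (intro exI allI impI conjI)
  fix I
  assume I: "is_piqp I"
  obtain s k where e: "\<And>t. exec program (load I, t) = return_spmf (s, t + k)"
      and k: "k \<le> 600 * com_size program * (input_size I + 1) ^ 6"
    using exec_program[OF I] by blast
  show "lossless_spmf (exec program (load I, 0))" by (simp add: e)
  let ?q = "Polynomial.smult (600 * com_size program) ([:1, 1:] ^ 6)"
  show "\<forall>(s, t)\<in>set_spmf (exec program (load I, 0)). t \<le> poly ?q (input_size I)"
    using k by (simp add: e)
qed

section \<open>Approximation\<close>

definition indicator_vec :: "nat \<Rightarrow> nat set \<Rightarrow> nat vec" where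
  "indicator_vec n S = vec n (\<lambda>v. of_bool (v \<in> S))"

lemma scalar_prod_indicator_vec:
  assumes "S \<subseteq> {..<n}"
  shows "f \<bullet> indicator_vec n S = (\<Sum>v\<in>S. f $ v)"
proof -
  have "f \<bullet> indicator_vec n S = (\<Sum>v<n. f $ v * of_bool (v \<in> S))"
    by (simp add: scalar_prod_def indicator_vec_def lessThan_atLeast0 del: sum_mult_of_bool_eq)
  also have "\<dots> = (\<Sum>v\<in>S. f $ v)"
    using assms by (intro sum.mono_neutral_cong_right) auto
  finally show ?thesis .
qed

locale piqp_instance =
  fixes I :: piqp
  assumes I: "is_piqp I"
begin

sublocale bounded_machine_input "load I" "nvars I" "nconstr I" "\<lambda>v. lin I $ v" "numer I" "denom I"
  "\<lambda>i v. constr I $$ (i, v)" "\<lambda>u v. quad I $$ (u, v)" "2 ^ (6 * input_size I)"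
  by (rule bounded_machine_input_load[OF I])

lemma carriers: "quad I \<in> carrier_mat (nvars I) (nvars I)" "constr I \<in> carrier_mat (nconstr I) (nvars I)"
  using I by (auto simp: is_piqp_def)

lemma feasible_indicator_vec:
  assumes S: "S \<subseteq> {..<nvars I}"
  shows "feasible I (indicator_vec (nvars I) S) \<longleftrightarrow> fits S"
proof -
  have "of_nat (row (constr I) i \<bullet> indicator_vec (nvars I) S) \<le> bound I $ i \<longleftrightarrow>
      denom I i * (\<Sum>v\<in>S. constr I $$ (i, v)) \<le> numer I i" if i: "i < nconstr I" for i
  proof -
    let ?s = "\<Sum>v\<in>S. constr I $$ (i, v)"
    have "row (constr I) i \<bullet> indicator_vec (nvars I) S = ?s"
      unfolding scalar_prod_indicator_vec[OF S] using S carriers i by (intro sum.cong) auto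
    moreover have "(of_nat ?s :: rat) \<le> of_nat (numer I i) / of_nat (denom I i) \<longleftrightarrow>
        (of_nat (denom I i * ?s) :: rat) \<le> of_nat (numer I i)"
      using bound_fraction(3)[OF I i] by (simp add: field_simps)
    ultimately show ?thesis using bound_fraction(1)[OF I i] by (simp only: of_nat_le_iff)
  qed
  then show ?thesis by (auto simp: feasible_def fits_def indicator_vec_def)
qed

lemma objective_indicator_vec:
  assumes S: "S \<subseteq> {..<nvars I}"
  shows "objective I (indicator_vec (nvars I) S) = gain S"
proof -
  let ?X = "indicator_vec (nvars I) S"
  have X: "?X \<in> carrier_vec (nvars I)" by (simp add: indicator_vec_def)
  have "?X \<bullet> (quad I *\<^sub>v ?X) = (quad I *\<^sub>v ?X) \<bullet> ?X"
    using X carriers by (intro comm_scalar_prod) auto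
  also have "\<dots> = (\<Sum>u\<in>S. \<Sum>v\<in>S. quad I $$ (u, v))"
    unfolding scalar_prod_indicator_vec[OF S]
  proof (rule sum.cong[OF refl])
    fix u
    assume "u \<in> S"
    then have u: "u < nvars I" using S by auto
    then have "(quad I *\<^sub>v ?X) $ u = row (quad I) u \<bullet> ?X" using carriers by simp
    also have "\<dots> = (\<Sum>v\<in>S. quad I $$ (u, v))"
      unfolding scalar_prod_indicator_vec[OF S] using S carriers u by (intro sum.cong) auto
    finally show "(quad I *\<^sub>v ?X) $ u = (\<Sum>v\<in>S. quad I $$ (u, v))" .
  qed
  finally show ?thesis
    by (simp add: objective_def gain_def scalar_prod_indicator_vec[OF S] sum.distrib)
qed

lemma feasible_as_indicator_vec:
  assumes "feasible I X"
  obtains S where "S \<subseteq> {..<nvars I}" "X = indicator_vec (nvars I) S"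
proof
  show "{v. v < nvars I \<and> X $ v = 1} \<subseteq> {..<nvars I}" by auto
  show "X = indicator_vec (nvars I) {v. v < nvars I \<and> X $ v = 1}"
    using assms by (intro eq_vecI) (auto simp: feasible_def indicator_vec_def)
qed

text \<open>\<open>optimum\<close> is a \<open>Max\<close>, so it has to be attained first: feasible
  vectors are indicators of subsets of a finite set, and the empty set is always feasible.\<close>

lemma optimum_le:
  assumes "\<And>S. S \<subseteq> {..<nvars I} \<Longrightarrow> fits S \<Longrightarrow> real (gain S) \<le> r"
  shows "real (optimum I) \<le> r"
proof -
  let ?F = "{X. feasible I X}"
  have "?F \<subseteq> indicator_vec (nvars I) ` Pow {..<nvars I}"
    by (auto elim!: feasible_as_indicator_vec)
  then have fin: "finite (objective I ` ?F)" by (intro finite_imageI) (auto elim: finite_subset)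
  have "feasible I (indicator_vec (nvars I) {})"
    by (simp add: feasible_indicator_vec fits_def)
  then have "objective I ` ?F \<noteq> {}" by auto
  then have "optimum I \<in> objective I ` ?F" unfolding optimum_def using fin by (intro Max_in)
  then obtain X where X: "feasible I X" "optimum I = objective I X" by auto
  from X(1) obtain S where S: "S \<subseteq> {..<nvars I}" "X = indicator_vec (nvars I) S"
    by (rule feasible_as_indicator_vec)
  then show ?thesis
    using assms[of S] X by (simp add: feasible_indicator_vec objective_indicator_vec)
qed

lemma entry_le_a_max:
  assumes "i < nconstr I" "v < nvars I"
  shows "constr I $$ (i, v) \<le> a_max I"
proof -
  have "finite (elements_mat (constr I))" by (simp add: elements_mat_def)
  then show ?thesis
    unfolding a_max_def using assms carriers by (intro Max_ge) (auto intro!: elements_matI)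
qed

text \<open>The run is a point mass on a good solution, so the success probability is 1.\<close>

lemma approximates_whp_program:
  assumes b: "0 < b" "\<And>i. i < nconstr I \<Longrightarrow> b \<le> real_of_rat (bound I $ i)"
    and \<alpha>: "max 1 (78 * (real (nconstr I))\<^sup>2 * (real (nvars I) * real (a_max I) / b)) \<le> \<alpha>"
  shows "approximates_whp program I \<alpha>"
proof -
  obtain s k where e: "\<And>t. exec program (load I, t) = return_spmf (s, t + k)"
      and best: "best_among num_candidates s"
    using exec_program[OF I] by blast
  obtain S where S: "S \<subseteq> {..<nvars I}" "fits S" "\<forall>v<nvars I. s ''X'' v = of_bool (v \<in> S)"
      "\<And>k. k < num_candidates \<Longrightarrow> fits (candidate k) \<Longrightarrow> gain (candidate k) \<le> gain S"
    using best by (auto simp: best_among_def)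
  have result: "result I s = indicator_vec (nvars I) S"
    using S(3) by (intro eq_vecI) (auto simp: result_def indicator_vec_def)
  have "real (optimum I) \<le> \<alpha> * real (gain S)"
  proof (rule optimum_le)
    fix T
    assume T: "T \<subseteq> {..<nvars I}" "fits T"
    have "real (gain T) \<le>
        max 1 (78 * (real (nconstr I))\<^sup>2 * (real (nvars I) * real (a_max I) / b)) * real (gain S)"
    proof (rule best_candidate_approximates[OF _ _ _ b(1) _ _ T])
      show "0 < lin I $ v" if "v < nvars I" for v using I that by (simp add: is_piqp_def)
      show "b \<le> real (numer I i) / real (denom I i)" if "i < nconstr I" for i
        using b(2)[OF that] bound_fraction(1)[OF I that] by (simp add: of_rat_divide)
    qed (use bound_fraction(3)[OF I] entry_le_a_max S(4) in auto)
    also have "\<dots> \<le> \<alpha> * real (gain S)" by (intro mult_right_mono \<alpha>) simp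
    finally show "real (gain T) \<le> \<alpha> * real (gain S)" .
  qed
  moreover have "0 < \<alpha>" using \<alpha> by simp
  ultimately have "approx_solution I \<alpha> (result I s)"
    unfolding approx_solution_def result
    using S(1,2) by (simp add: feasible_indicator_vec objective_indicator_vec field_simps)
  moreover have "run program I = return_spmf (result I s)" by (simp add: run_def e)
  ultimately have "measure (measure_spmf (run program I)) {X. approx_solution I \<alpha> X} = 1"
    by (simp add: measure_spmf_return_spmf measure_return)
  then show ?thesis by (simp add: approximates_whp_def)
qed

end

text \<open>The truncation by \<open>max 1\<close> accounts for large \<open>\<beta> n\<close>: the
  product may then lie strictly between 0 and 1, and no feasible vector exceeds the optimum.\<close>

theorem theorem4p1:
  fixes \<beta> :: "nat \<Rightarrow> real" and \<gamma> :: real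
  assumes "\<And>n. \<beta> n > 0" and "\<gamma> > 0"
  shows "\<exists>M. polynomial_time M \<and>
    (\<exists>C > 0. \<forall>\<^sub>F n in sequentially. \<forall>I.
       is_piqp I \<and> nvars I = n \<and> real (nconstr I) \<le> log 2 (real n) \<and>
       (\<forall>i < nconstr I. real_of_rat (bound I $ i) \<ge> \<beta> n) \<longrightarrow>
       approximates_whp M I
         (max 1 (C * (real (a_max I) * (real n / \<beta> n) * log 2 (real n) powr (2 + \<gamma>)))))"
proof (intro exI[of _ program] conjI polynomial_time_program exI[of _ 78])
  show "\<forall>\<^sub>F n in sequentially. \<forall>I.
       is_piqp I \<and> nvars I = n \<and> real (nconstr I) \<le> log 2 (real n) \<and>
       (\<forall>i < nconstr I. real_of_rat (bound I $ i) \<ge> \<beta> n) \<longrightarrow>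
       approximates_whp program I
         (max 1 (78 * (real (a_max I) * (real n / \<beta> n) * log 2 (real n) powr (2 + \<gamma>))))"
    \<comment> \<open>From 2 on the logarithm is at least 1, so enlarging the exponent from 2 to
      \<open>2 + \<gamma>\<close> does not decrease the power.\<close>
    using eventually_ge_at_top[of 2]
  proof (eventually_elim, intro allI impI)
    fix n :: nat and I
    assume n: "2 \<le> n" and asm: "is_piqp I \<and> nvars I = n \<and> real (nconstr I) \<le> log 2 (real n) \<and>
       (\<forall>i < nconstr I. real_of_rat (bound I $ i) \<ge> \<beta> n)"
    interpret piqp_instance I using asm by unfold_locales simp
    let ?L = "log 2 (real n)"
    have L: "1 \<le> ?L" using n by (simp add: le_log_iff)
    have "(real (nconstr I))\<^sup>2 \<le> ?L\<^sup>2" using asm by (intro power_mono) auto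
    also have "\<dots> = ?L powr 2" using L by (simp add: powr_numeral)
    also have "\<dots> \<le> ?L powr (2 + \<gamma>)" using L assms(2) by (intro powr_mono) auto
    finally have p: "(real (nconstr I))\<^sup>2 \<le> ?L powr (2 + \<gamma>)" .
    let ?r = "real n * real (a_max I) / \<beta> n"
    have "78 * (real (nconstr I))\<^sup>2 * ?r \<le> 78 * ?L powr (2 + \<gamma>) * ?r"
      using assms(1)[of n] by (intro mult_right_mono mult_left_mono p) simp_all
    also have "\<dots> = 78 * (real (a_max I) * (real n / \<beta> n) * ?L powr (2 + \<gamma>))" by simp
    finally have "max 1 (78 * (real (nconstr I))\<^sup>2 * (real (nvars I) * real (a_max I) / \<beta> n)) \<le>
        max 1 (78 * (real (a_max I) * (real n / \<beta> n) * ?L powr (2 + \<gamma>)))"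
      using asm by (intro max.mono) auto
    then show "approximates_whp program I
         (max 1 (78 * (real (a_max I) * (real n / \<beta> n) * ?L powr (2 + \<gamma>))))"
      using asm by (intro approximates_whp_program[OF assms(1)[of n]]) auto
  qed
qed simp

end
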